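(* Let $C_n(2)$ be the number of $2$-colored partitions $\Lambda$ of $[n]$ with $\mathrm{cr}(\Lambda)<2$ (with $C_0(2)=1$). If $n$ is a positive integer then $C_n(2)$ equals the constant coefficient of the Laurent polynomial \[\bigl(1-x^2y^{-1}+x^3-x^2y^2+y^3-x^{-1}y^2\bigr)\bigl(3+x+y+x^{-1}+y^{-1}+xy^{-1}+x^{-1}y\bigr)^{n-1},\] and for all nonnegative integers $n$, \[9n(n+3)\,C_n(2)-2(5n^2+26n+30)\,C_{n+1}(2)+(n+4)(n+5)\,C_{n+2}(2)=0.\] Consequently the generating function $\sum_{n\ge0}C_n(2)x^n$ is D-finite.
   Context: For a partition $P$ of $[n]=\{1,\dots,n\}$ (a set of disjoint nonempty blocks with union $[n]$), $\mathrm{Arc}(P)$ is the set of pairs $(i,j)$ with $i,j$ in the same block and $j$ the least element of that block greater than $i$. A $2$-crossing is a pair of arcs $(i_1,j_1),(i_2,j_2)$ with $i_1<i_2<j_1<j_2$. A $2$-colored partition is $\Lambda=(P,\varphi)$ with $\varphi:\mathrm{Arc}(P)\to\{1,2\}$; $\mathrm{cr}(\Lambda)<2$ means $P$ has no $2$-crossing whose two arcs have the same color. A power series $y\in\mathbb{Q}[[x]]$ is D-finite if $y,y',y'',\dots$ span a finite-dimensional vector space over $\mathbb{Q}(x)$. *)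

theory Defs
  imports
    "HOL-Library.Disjoint_Sets"
    "HOL-Library.FuncSet"
    "HOL-Library.Poly_Mapping"
    "HOL-Library.Product_Plus"
    "HOL-Computational_Algebra.Computational_Algebra"
begin

definition arcs :: "nat set set \<Rightarrow> (nat \<times> nat) set" where
  "arcs P = {(i, j). \<exists>B\<in>P. i \<in> B \<and> j \<in> B \<and> i < j \<and> (\<forall>k\<in>B. i < k \<longrightarrow> j \<le> k)}"

definition crossing :: "nat \<times> nat \<Rightarrow> nat \<times> nat \<Rightarrow> bool" where
  "crossing a b \<longleftrightarrow> fst a < fst b \<and> fst b < snd a \<and> snd a < snd b"

text \<open>
  Colourings are extensional functions on the arc set, so that distinct pairs are distinct
  coloured partitions and the set is finite.
\<close>

definition colored_partitions :: "nat \<Rightarrow> (nat set set \<times> (nat \<times> nat \<Rightarrow> nat)) set" where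
  "colored_partitions n =
     {(P, \<phi>). partition_on {1..n} P \<and> \<phi> \<in> arcs P \<rightarrow>\<^sub>E {1, 2}}"

definition noncrossing_colored :: "nat set set \<times> (nat \<times> nat \<Rightarrow> nat) \<Rightarrow> bool" where
  "noncrossing_colored \<Lambda> \<longleftrightarrow>
     \<not> (\<exists>a\<in>arcs (fst \<Lambda>). \<exists>b\<in>arcs (fst \<Lambda>). crossing a b \<and> snd \<Lambda> a = snd \<Lambda> b)"

definition C2 :: "nat \<Rightarrow> nat" where
  "C2 n = card {\<Lambda> \<in> colored_partitions n. noncrossing_colored \<Lambda>}"

lemma C2_0: "C2 0 = 1"
proof -
  have "{\<Lambda> \<in> colored_partitions 0. noncrossing_colored \<Lambda>} = {({}, \<lambda>_. undefined)}"
    by (auto simp: colored_partitions_def noncrossing_colored_def arcs_def partition_on_empty)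
  then show ?thesis
    by (simp add: C2_def)
qed

text \<open>
  Integral Laurent polynomials in two variables are the finitely supported functions
  on the exponent group of pairs of integers, with the convolution product;
  the pair \<open>(a, b)\<close> stands for \<open>x\<^sup>a y\<^sup>b\<close>.
\<close>

type_synonym laurent2 = "(int \<times> int) \<Rightarrow>\<^sub>0 int"

definition mon :: "int \<Rightarrow> int \<Rightarrow> laurent2" where
  "mon a b = Poly_Mapping.single (a, b) 1"

definition const_coeff :: "laurent2 \<Rightarrow> int" where
  "const_coeff p = Poly_Mapping.lookup p (0, 0)"

text \<open>
  The field of rational functions acts on Laurent series by multiplication with the
  expansion at \<open>0\<close>; formal power series are viewed inside this vector space.
\<close>

definition ratfun_to_fls :: "rat poly fract \<Rightarrow> rat fls" where
  "ratfun_to_fls r =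
     (THE f. \<exists>p q. q \<noteq> 0 \<and> r = Fract p q \<and>
        f = fps_to_fls (fps_of_poly p) / fps_to_fls (fps_of_poly q))"

lemma ratfun_to_fls_Fract:
  assumes "q \<noteq> 0"
  shows "ratfun_to_fls (Fract p q) = fps_to_fls (fps_of_poly p) / fps_to_fls (fps_of_poly q)"
  unfolding ratfun_to_fls_def
proof (rule the_equality)
  show "\<exists>p' q'. q' \<noteq> 0 \<and> Fract p q = Fract p' q' \<and>
      fps_to_fls (fps_of_poly p) / fps_to_fls (fps_of_poly q) =
      fps_to_fls (fps_of_poly p') / fps_to_fls (fps_of_poly q')"
    using assms by blast
next
  fix f
  assume "\<exists>a b. b \<noteq> 0 \<and> Fract p q = Fract a b \<and>
      f = fps_to_fls (fps_of_poly a) / fps_to_fls (fps_of_poly b)"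
  then obtain a b where b: "b \<noteq> 0" and ab: "Fract p q = Fract a b"
    and f: "f = fps_to_fls (fps_of_poly a) / fps_to_fls (fps_of_poly b)"
    by blast
  from ab have "a * q = p * b"
    using assms b by (simp add: eq_fract)
  then have "fps_to_fls (fps_of_poly (a * q)) = fps_to_fls (fps_of_poly (p * b))"
    by simp
  with assms b show "f = fps_to_fls (fps_of_poly p) / fps_to_fls (fps_of_poly q)"
    by (simp add: f fps_of_poly_mult fls_times_fps_to_fls frac_eq_eq)
qed

lemma ratfun_to_fls_1: "ratfun_to_fls 1 = 1"
  by (simp add: One_fract_def ratfun_to_fls_Fract)

lemma ratfun_to_fls_add: "ratfun_to_fls (r + s) = ratfun_to_fls r + ratfun_to_fls s"
  by (cases r; cases s)
     (simp add: ratfun_to_fls_Fract fps_of_poly_mult fps_of_poly_add fls_times_fps_to_fls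
        add_frac_eq mult.commute)

lemma ratfun_to_fls_mult: "ratfun_to_fls (r * s) = ratfun_to_fls r * ratfun_to_fls s"
  by (cases r; cases s)
     (simp add: ratfun_to_fls_Fract fps_of_poly_mult fls_times_fps_to_fls)

definition ratfun_scale :: "rat poly fract \<Rightarrow> rat fls \<Rightarrow> rat fls" where
  "ratfun_scale r f = ratfun_to_fls r * f"

global_interpretation ratfun: vector_space ratfun_scale
  by unfold_locales
     (simp_all add: ratfun_scale_def ratfun_to_fls_1 ratfun_to_fls_add ratfun_to_fls_mult
        algebra_simps)

text \<open>
  Finite dimension is expressed by a finite spanning set, as \<open>dim\<close> is also \<open>0\<close> for
  infinite-dimensional spaces.
\<close>

definition D_finite :: "rat fps \<Rightarrow> bool" where
  "D_finite y \<longleftrightarrow>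
     (\<exists>B. finite B \<and>
        ratfun.span (range (\<lambda>k. fps_to_fls ((fps_deriv ^^ k) y))) = ratfun.span B)"

end

theory Submission
  imports Defs
begin

text \<open>
  Read the vertices \<open>1, \<dots>, n\<close> from left to right, keeping track of the numbers \<open>(a, b)\<close> of open arcs
  of the two colours. At each vertex one may close an arc, which has to be the last opened one of
  its colour to avoid a crossing, and then open one. The first vertex closes and the last opens
  nothing, so the operations regroup into \<open>n - 1\<close> steps of the form open-then-close. These are the
  steps of a walk in the quarter plane with step polynomial
  \<open>S = 3 + x + y + 1/x + 1/y + x/y + y/x\<close>, and the reflection principle for the Weyl group of type
  \<open>A\<^sub>2\<close> counts the closed walks by the constant term.

  For the recurrence, \<open>S\<close> is invariant under the twelve symmetries of the hexagonal lattice, and the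
  coefficients of \<open>S\<^sup>n\<close> satisfy two linear contiguity relations. They express all the coefficients
  needed by those at \<open>(0, 0)\<close> and \<open>(1, 0)\<close>, and these two obey a first-order system in \<open>n\<close>.
  The recurrence becomes a second-order differential equation with polynomial coefficients for the
  generating function \<open>y\<close>, so all its derivatives lie in the span of \<open>1, y, y'\<close>.
\<close>

section \<open>Walks on the hexagonal lattice\<close>

text \<open>The coefficient of x^a y^b in S^n. The weight 3 counts the ways of keeping both numbers
  of open arcs: doing nothing, or opening an arc and then closing one of the same colour, for either
  colour.\<close>

fun hexw :: "nat \<Rightarrow> int \<Rightarrow> int \<Rightarrow> int" where
  "hexw 0 a b = (if a = 0 \<and> b = 0 then 1 else 0)"
| "hexw (Suc n) a b = 3 * hexw n a b + hexw n (a - 1) b + hexw n a (b - 1) + hexw n (a + 1) b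
     + hexw n a (b + 1) + hexw n (a - 1) (b + 1) + hexw n (a + 1) (b - 1)"

lemma hexw_swap: "hexw n a b = hexw n b a"
  by (induction n arbitrary: a b) auto

lemma hexw_uminus: "hexw n (- a) (- b) = hexw n a b"
proof (induction n arbitrary: a b)
  case (Suc n)
  have "- a - 1 = - (a + 1)" "- b - 1 = - (b + 1)" "- a + 1 = - (a - 1)" "- b + 1 = - (b - 1)"
    by simp_all
  then show ?case
    using Suc by (simp only: hexw.simps)
qed auto

text \<open>The map (a, b) -> (-a, a + b) is a simple reflection of the A2 lattice. It fixes the
  steps (0, 1) and (0, -1) and exchanges (1, 0) with (-1, 1) and (-1, 0) with (1, -1). Together with
  the swap and the point reflection it generates all twelve symmetries.\<close>

lemma hexw_reflect: "hexw n (- a) (a + b) = hexw n a b"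
proof (induction n arbitrary: a b)
  case (Suc n)
  have m: "- a - 1 = - 1 - a"
    by simp
  have "hexw n (- a) (a + b) = hexw n a b"
    "hexw n (- a - 1) (a + b) = hexw n (a + 1) (b - 1)"
    "hexw n (- a) (a + b - 1) = hexw n a (b - 1)"
    "hexw n (- a + 1) (a + b) = hexw n (a - 1) (b + 1)"
    "hexw n (- a) (a + b + 1) = hexw n a (b + 1)"
    "hexw n (- a - 1) (a + b + 1) = hexw n (a + 1) b"
    "hexw n (- a + 1) (a + b - 1) = hexw n (a - 1) b"
    unfolding m using Suc[of a b] Suc[of "a+1" "b-1"] Suc[of a "b-1"] Suc[of "a-1" "b+1"] Suc[of a "b+1"]
      Suc[of "a+1" b] Suc[of "a-1" b] by (simp_all add: algebra_simps)
  then show ?case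
    by (simp only: hexw.simps)
qed auto

text \<open>
  Coefficients of \<open>x \<partial>\<^sub>x S\<^bsup>n+1\<^esup> = (n + 1) S\<^sup>n (x \<partial>\<^sub>x S)\<close>.
\<close>

lemma hexw_contiguity_euler:
  "a * hexw (Suc n) a b = (int n + 1) *
     (hexw n (a - 1) b + hexw n (a - 1) (b + 1) - hexw n (a + 1) b - hexw n (a + 1) (b - 1))"
proof (induction n arbitrary: a b)
  case 0
  show ?case by auto
next
  case (Suc n)
  define h where "h = hexw (Suc n)"
  define D where "D a b = hexw n (a - 1) b + hexw n (a - 1) (b + 1)
    - hexw n (a + 1) b - hexw n (a + 1) (b - 1)" for a b
  have IH: "a * h a b = (int n + 1) * D a b" for a b
    unfolding h_def D_def by (rule Suc)
  \<comment> \<open>This is the product rule for S * S^(n+1): writing the factor \<open>a\<close> of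
    a shifted term as its first coordinate plus or minus 1 splits off the contribution of x
    dS/dx.\<close>
  have "a * hexw (Suc (Suc n)) a b = 3 * (a * h a b) + (a - 1) * h (a - 1) b + a * h a (b - 1)
     + (a + 1) * h (a + 1) b + a * h a (b + 1) + (a - 1) * h (a - 1) (b + 1)
     + (a + 1) * h (a + 1) (b - 1)
     + (h (a - 1) b + h (a - 1) (b + 1) - h (a + 1) b - h (a + 1) (b - 1))"
    by (subst hexw.simps, fold h_def) (simp add: algebra_simps)
  also have "\<dots> = (int n + 1) * (3 * D a b + D (a-1) b + D a (b-1) + D (a+1) b + D a (b+1)
       + D (a-1) (b+1) + D (a+1) (b-1))
     + (h (a - 1) b + h (a - 1) (b + 1) - h (a + 1) b - h (a + 1) (b - 1))"
    unfolding IH by (simp add: algebra_simps)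
  also have "3 * D a b + D (a-1) b + D a (b-1) + D (a+1) b + D a (b+1)
       + D (a-1) (b+1) + D (a+1) (b-1)
      = h (a - 1) b + h (a - 1) (b + 1) - h (a + 1) b - h (a + 1) (b - 1)"
    unfolding D_def h_def by simp
  finally show ?case
    by (simp add: h_def algebra_simps)
qed

text \<open>
  Since \<open>S = (1 + x + y) (1 + 1/x + 1/y)\<close>, in homogeneous coordinates \<open>xyz S = e\<^sub>1 e\<^sub>2\<close>. The vector field
  \<open>(y - z) \<partial>\<^sub>x + (z - x) \<partial>\<^sub>y + (x - y) \<partial>\<^sub>z\<close> annihilates both \<open>e\<^sub>1\<close> and \<open>e\<^sub>2\<close>; the relation compares
  coefficients after applying it to \<open>S\<^sup>n\<close>.
\<close>

lemma hexw_contiguity_rotation: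
  "(int n + a + 1) * (hexw n (a + 1) (b - 1) - hexw n (a + 1) b)
   + (int n + b + 1) * (hexw n a (b + 1) - hexw n (a - 1) (b + 1))
   + (int n - a - b + 1) * (hexw n (a - 1) b - hexw n a (b - 1)) = 0"
proof (induction n arbitrary: a b)
  case 0
  show ?case by auto
next
  case (Suc n)
  define R where "R a b = (int n + a + 1) * (hexw n (a + 1) (b - 1) - hexw n (a + 1) b)
   + (int n + b + 1) * (hexw n a (b + 1) - hexw n (a - 1) (b + 1))
   + (int n - a - b + 1) * (hexw n (a - 1) b - hexw n a (b - 1))" for a b
  have R0: "R a b = 0" for a b
    unfolding R_def by (rule Suc)
  \<comment> \<open>The relation for \<open>Suc n\<close> is the step operator applied to the
    relation for \<open>n\<close>: the increase of \<open>n\<close> in the factors compensates for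
    their dependence on \<open>a\<close> and \<open>b\<close>.\<close>
  have "(int (Suc n) + a + 1) * (hexw (Suc n) (a + 1) (b - 1) - hexw (Suc n) (a + 1) b)
   + (int (Suc n) + b + 1) * (hexw (Suc n) a (b + 1) - hexw (Suc n) (a - 1) (b + 1))
   + (int (Suc n) - a - b + 1) * (hexw (Suc n) (a - 1) b - hexw (Suc n) a (b - 1))
   = 3 * R a b + R (a-1) b + R a (b-1) + R (a+1) b + R a (b+1) + R (a-1) (b+1) + R (a+1) (b-1)"
    unfolding R_def by (simp add: algebra_simps)
  then show ?case
    unfolding R0 by simp
qed

section \<open>Powers of the step polynomial and walks in the Weyl chamber\<close>

definition step_poly :: laurent2 where
  "step_poly = 3 + mon 1 0 + mon 0 1 + mon (-1) 0 + mon 0 (-1) + mon 1 (-1) + mon (-1) 1"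

lemma lookup_mon_times:
  "Poly_Mapping.lookup (mon a b * p) (c, d) = Poly_Mapping.lookup p (c - a, d - b)"
proof -
  have *: "(c, d) = (a, b) + q \<longleftrightarrow> q = (c - a, d - b)" for q :: "int \<times> int"
    by (cases q) auto
  then have "Poly_Mapping.lookup (mon a b * p) (c, d)
      = (\<Sum>l. (if l = (a, b) then 1 else 0) * (\<Sum>q. Poly_Mapping.lookup p q when (c, d) = l + q))"
    by (simp add: mon_def lookup_mult lookup_single)
  also have "\<dots> = (\<Sum>q. Poly_Mapping.lookup p q when (c, d) = (a, b) + q)"
    by (subst Sum_any.expand_superset[of "{(a, b)}"]) auto
  finally show ?thesis
    by (simp only: *) simp
qed

lemma lookup_step_poly_power: "Poly_Mapping.lookup (step_poly ^ n) (a, b) = hexw n a b"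
proof (induction n arbitrary: a b)
  case 0
  show ?case by (simp add: lookup_one zero_prod_def)
next
  case (Suc n)
  have "3 * p = p + p + p" for p :: laurent2
    by (simp add: algebra_simps)
  then have 3: "Poly_Mapping.lookup (3 * p) k = 3 * Poly_Mapping.lookup p k" for p :: laurent2 and k
    by (simp only: lookup_add)
  show ?case
    by (subst power_Suc, subst step_poly_def) (simp add: distrib_right lookup_add lookup_mon_times Suc 3)
qed

text \<open>
  The alternating sum over the Weyl group orbit of \<open>(1, 1)\<close>, with the walls at \<open>a = -1\<close> and \<open>b = -1\<close>.
\<close>

definition chamber_walks :: "nat \<Rightarrow> int \<Rightarrow> int \<Rightarrow> int" where
  "chamber_walks n a b = hexw n a b - hexw n (a + 2) (b - 1) - hexw n (a - 1) (b + 2)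
     + hexw n a (b + 3) + hexw n (a + 3) b - hexw n (a + 2) (b + 2)"

text \<open>Every summand is a translate of \<open>hexw\<close>, and the walk recursion is linear
  and translation invariant.\<close>

lemma chamber_walks_Suc:
  "chamber_walks (Suc n) a b = 3 * chamber_walks n a b + chamber_walks n (a - 1) b
     + chamber_walks n a (b - 1) + chamber_walks n (a + 1) b + chamber_walks n a (b + 1)
     + chamber_walks n (a - 1) (b + 1) + chamber_walks n (a + 1) (b - 1)"
  by (simp add: chamber_walks_def algebra_simps)

text \<open>The other five summands start their walks at reflected points, all of which lie outside
  the quadrant.\<close>

lemma chamber_walks_0:
  "a \<ge> 0 \<Longrightarrow> b \<ge> 0 \<Longrightarrow> chamber_walks 0 a b = (if a = 0 \<and> b = 0 then 1 else 0)"
  by (auto simp: chamber_walks_def)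

text \<open>On the wall the six summands cancel in pairs of opposite sign, each pair being exchanged
  by \<open>hexw_reflect\<close>.\<close>

lemma chamber_walks_wall1: "chamber_walks n (- 1) b = 0"
  using hexw_reflect[of n 1 "b - 1"] hexw_reflect[of n 2 b] hexw_reflect[of n 1 "b + 2"]
  by (simp add: chamber_walks_def algebra_simps)

lemma chamber_walks_swap: "chamber_walks n a b = chamber_walks n b a"
  unfolding chamber_walks_def
  using hexw_swap[of n a b] hexw_swap[of n "a+2" "b-1"] hexw_swap[of n "a-1" "b+2"]
    hexw_swap[of n a "b+3"] hexw_swap[of n "a+3" b] hexw_swap[of n "a+2" "b+2"] by simp

lemma chamber_walks_wall2: "chamber_walks n a (- 1) = 0"
  using chamber_walks_wall1 chamber_walks_swap by metis

text \<open>A factor x^i y^j picks out the coefficient of S^n at (-i, -j); the point reflection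
  turns it into the one at (i, j).\<close>

lemma const_coeff_eq_chamber_walks:
  "const_coeff ((1 - mon 2 (-1) + mon 3 0 - mon 2 2 + mon 0 3 - mon (-1) 2) * step_poly ^ n)
   = chamber_walks n 0 0"
  using hexw_uminus[of n 2 "-1"] hexw_uminus[of n 3 0] hexw_uminus[of n 2 2]
    hexw_uminus[of n 0 3] hexw_uminus[of n "-1" 2]
  by (simp add: const_coeff_def chamber_walks_def left_diff_distrib distrib_right lookup_add
      lookup_minus lookup_mon_times lookup_step_poly_power)

section \<open>The recurrence\<close>

lemma hexw_orbits:
  "hexw n 0 1 = hexw n 1 0" "hexw n 1 (-1) = hexw n 1 0" "hexw n 0 (-1) = hexw n 1 0"
  "hexw n (-1) 0 = hexw n 1 0" "hexw n (-1) 1 = hexw n 1 0"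
  "hexw n 2 (-1) = hexw n 1 1" "hexw n (-1) 2 = hexw n 1 1"
  "hexw n 0 2 = hexw n 2 0"
  "hexw n 1 2 = hexw n 2 1" "hexw n 3 (-1) = hexw n 2 1"
  "hexw n 0 3 = hexw n 3 0"
  using hexw_swap[of n 0 1] hexw_swap[of n 1 "-1"] hexw_swap[of n 0 "-1"] hexw_swap[of n 2 "-1"]
    hexw_swap[of n 0 2] hexw_swap[of n 1 2] hexw_swap[of n 3 "-1"] hexw_swap[of n 0 3]
    hexw_reflect[of n 1 0] hexw_reflect[of n 1 1] hexw_reflect[of n 1 2] hexw_uminus[of n 1 0]
  by simp_all

text \<open>The letters stand for one value per symmetry orbit. The first four equations expand the
  value at \<open>Suc n\<close> both by the walk recursion and by the Euler relation, at (1, 0), (1,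
  1), (1, 2) and (2, 1); the last two of these points share an orbit but give different equations.
  The next two are the rotation relation at (1, 0) and (2, 0).\<close>

lemma hexw_orbit_relations:
  fixes n :: nat
  defines "N \<equiv> int n" and "a \<equiv> hexw n 0 0" and "b \<equiv> hexw n 1 0" and "c \<equiv> hexw n 1 1"
    and "d \<equiv> hexw n 2 0" and "e \<equiv> hexw n 2 1" and "f \<equiv> hexw n 3 0" and "g \<equiv> hexw n 2 2"
    and "k \<equiv> hexw n 3 1"
  shows "a + 5 * b + 2 * c + d = (N + 1) * (a + b - c - d)"
    and "3 * c + 2 * b + 2 * d + 2 * e = (N + 1) * (b - e)"
    and "4 * e + c + d + k + g + f = (N + 1) * (d + f - g - e)"
    and "2 * (4 * e + c + d + k + g + f) = (N + 1) * (c + e - k - f)"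
    and "(N + 2) * (c - d) + (N + 1) * (c - b) + N * (a - b) = 0"
    and "(N + 3) * (e - f) + (N + 1) * (e - c) + (N - 1) * (b - c) = 0"
    and "hexw (Suc n) 0 0 = 3 * a + 6 * b"
    and "hexw (Suc n) 1 0 = (N + 1) * (a + b - c - d)"
    and "chamber_walks n 0 0 = a - 2 * c + 2 * f - g"
  unfolding assms
  using hexw_contiguity_euler[of 1 n 0] hexw_contiguity_euler[of 1 n 1]
  by (simp_all add: hexw_orbits chamber_walks_def algebra_simps,
      use hexw_contiguity_euler[of 1 n 2] in \<open>simp add: hexw_orbits algebra_simps\<close>,
      use hexw_contiguity_euler[of 2 n 1] in \<open>simp add: hexw_orbits algebra_simps\<close>,
      use hexw_contiguity_rotation[of n 1 0] in \<open>simp add: hexw_orbits algebra_simps\<close>,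
      use hexw_contiguity_rotation[of n 2 0] in \<open>simp add: hexw_orbits algebra_simps\<close>)

text \<open>Eliminating the values at (1, 1) and (2, 0) leaves those at (0, 0) and (1, 0). With
  \<open>hexw (Suc n) 0 0 = 3 * a + 6 * b\<close> this is the first-order system.\<close>

lemma hexw_Suc_1_0:
  "(int n + 2)\<^sup>2 * hexw (Suc n) 1 0 =
    (int n + 1) * (2 * (int n + 2) * hexw n 0 0 + (7 * int n + 11) * hexw n 1 0)"
  using hexw_orbit_relations(1,5,8)[of n] by algebra


text \<open>The orbit values are eliminated one after the other. The factor on the left collects the
  denominators: \<open>(N + 2)\<^sup>2\<close> from \<open>d\<close>, which also covers
  \<open>c\<close>, one \<open>N + 3\<close> from each of \<open>e\<close> and \<open>f\<close>, and
  \<open>N + 4\<close> from \<open>g\<close>.\<close>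

lemma chamber_walks_0_0:
  "(int n + 2)\<^sup>2 * (int n + 3)\<^sup>2 * (int n + 4) * chamber_walks n 0 0 =
    (144 + 64 * int n - 40 * int n ^ 2 - 22 * int n ^ 3 - 2 * int n ^ 4) * hexw n 0 0
    + (666 + 779 * int n + 256 * int n ^ 2 + 25 * int n ^ 3 + 2 * int n ^ 4) * hexw n 1 0"
proof -
  define N where "N = int n"
  define a b c d e f g k where "a = hexw n 0 0" and "b = hexw n 1 0" and "c = hexw n 1 1"
    and "d = hexw n 2 0" and "e = hexw n 2 1" and "f = hexw n 3 0" and "g = hexw n 2 2"
    and "k = hexw n 3 1"
  note R = hexw_orbit_relations[of n, folded N_def a_def b_def c_def d_def e_def f_def g_def k_def]
  have c: "(N + 2) * c = (N - 1) * b"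
    using R(1,5) by (simp add: algebra_simps)
  have "(N + 2) * d = N * a + (N - 4) * b - (N + 3) * c"
    using R(1) by (simp add: algebra_simps)
  then have "(N + 2)\<^sup>2 * d = (N + 2) * N * a + (N + 2) * (N - 4) * b - (N + 3) * ((N + 2) * c)"
    by algebra
  then have d: "(N + 2)\<^sup>2 * d = N * (N + 2) * a - (4 * N + 5) * b"
    unfolding c by algebra
  have "(N + 3) * e = (N - 1) * b - 3 * c - 2 * d"
    using R(2) by (simp add: algebra_simps)
  then have "(N + 2)\<^sup>2 * (N + 3) * e
      = (N + 2)\<^sup>2 * (N - 1) * b - 3 * (N + 2) * ((N + 2) * c) - 2 * ((N + 2)\<^sup>2 * d)"
    by algebra
  then have e: "(N + 2)\<^sup>2 * (N + 3) * e
      = (N + 2)\<^sup>2 * (N - 1) * b - 3 * (N + 2) * ((N - 1) * b) - 2 * (N * (N + 2) * a - (4 * N + 5) * b)"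
    unfolding c d .
  have f: "(N + 3) * f = (2 * N + 4) * e - 2 * N * c + (N - 1) * b"
    using R(6) by (simp add: algebra_simps)
  \<comment> \<open>Eliminating \<open>k\<close> from the two relations for the orbit of (2, 1)
    leaves a common factor \<open>N + 1\<close>, which is positive and is cancelled next.\<close>
  have "(N + 1) * ((N + 4) * g) = (N + 1) * ((N + 2) * d + (N + 3) * f - (N + 8) * e - 2 * c)"
    using R(3,4) by algebra
  then have g: "(N + 4) * g = (N + 2) * d + (N + 3) * f - (N + 8) * e - 2 * c"
    by (simp add: N_def)
  have "(N + 4) * chamber_walks n 0 0
      = (N + 4) * a - (2 * N + 6) * c - (N + 2) * d + (N + 8) * e + (N + 5) * f"
    unfolding R(9) using g by algebra
  then have "(N + 2)\<^sup>2 * (N + 3) * ((N + 3) * ((N + 4) * chamber_walks n 0 0))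
      = (N + 2)\<^sup>2 * (N + 3) * ((N + 3) * ((N + 4) * a - (2 * N + 6) * c - (N + 2) * d + (N + 8) * e)
         + (N + 5) * ((2 * N + 4) * e - 2 * N * c + (N - 1) * b))"
    unfolding f[symmetric] by algebra
  also have "\<dots> = (N + 2)\<^sup>2 * (N + 3)\<^sup>2 * (N + 4) * a
      - ((N + 3)\<^sup>2 * (2 * N + 6) + (N + 3) * (N + 5) * 2 * N) * (N + 2) * ((N + 2) * c)
      - (N + 3)\<^sup>2 * (N + 2) * ((N + 2)\<^sup>2 * d)
      + ((N + 3) * (N + 8) + (N + 5) * (2 * N + 4)) * ((N + 2)\<^sup>2 * (N + 3) * e)
      + (N + 2)\<^sup>2 * (N + 3) * (N + 5) * (N - 1) * b"
    by algebra
  also have "\<dots> = (144 + 64 * N - 40 * N ^ 2 - 22 * N ^ 3 - 2 * N ^ 4) * a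
    + (666 + 779 * N + 256 * N ^ 2 + 25 * N ^ 3 + 2 * N ^ 4) * b"
    unfolding c d e by algebra
  finally show ?thesis
    unfolding N_def[symmetric] a_def[symmetric] b_def[symmetric] by algebra
qed

text \<open>\<open>u n\<close> is the later count \<open>C2 (n + 1)\<close>, hence the
  \<open>n + 1\<close> in the coefficients. The first-order system expresses three consecutive
  values by \<open>hexw n 0 0\<close> and \<open>hexw n 1 0\<close>, and in the stated combination
  the coefficients of both vanish identically.\<close>

lemma chamber_walks_0_0_recurrence:
  defines "u \<equiv> \<lambda>n. chamber_walks n 0 0"
  shows "9 * (int n + 1) * (int n + 4) * u n
    - 2 * (5 * (int n + 1)\<^sup>2 + 26 * (int n + 1) + 30) * u (n + 1)
    + (int n + 5) * (int n + 6) * u (n + 2) = 0"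
proof -
  define N where "N = int n"
  define P where "P k = 144 + 64 * k - 40 * k ^ 2 - 22 * k ^ 3 - 2 * k ^ 4" for k :: int
  define Q where "Q k = 666 + 779 * k + 256 * k ^ 2 + 25 * k ^ 3 + 2 * k ^ 4" for k :: int
  define a b where "a k = hexw k 0 0" and "b k = hexw k 1 0" for k
  have u: "(int k + 2)\<^sup>2 * (int k + 3)\<^sup>2 * (int k + 4) * u k = P (int k) * a k + Q (int k) * b k" for k
    unfolding u_def P_def Q_def a_def b_def by (rule chamber_walks_0_0)
  have a: "a (Suc k) = 3 * a k + 6 * b k" for k
    unfolding a_def b_def by (rule hexw_orbit_relations)
  have b: "(int k + 2)\<^sup>2 * b (Suc k) = (int k + 1) * (2 * (int k + 2) * a k + (7 * int k + 11) * b k)" for k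
    unfolding a_def b_def by (rule hexw_Suc_1_0)
  have u0: "(N + 2)\<^sup>2 * (N + 3)\<^sup>2 * (N + 4) * u n = P N * a n + Q N * b n"
    using u[of n] by (simp add: N_def)
  have u1: "(N + 3)\<^sup>2 * (N + 4)\<^sup>2 * (N + 5) * u (n + 1)
      = P (N + 1) * (3 * a n + 6 * b n) + Q (N + 1) * b (Suc n)"
    using u[of "Suc n"] by (simp add: N_def a add_ac)
  have u2: "(N + 4)\<^sup>2 * (N + 5)\<^sup>2 * (N + 6) * u (n + 2)
      = P (N + 2) * (9 * a n + 18 * b n + 6 * b (Suc n)) + Q (N + 2) * b (Suc (Suc n))"
    using u[of "Suc (Suc n)"] by (simp add: N_def a add_ac)
  have b1: "(N + 2)\<^sup>2 * b (Suc n) = (N + 1) * (2 * (N + 2) * a n + (7 * N + 11) * b n)"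
    using b[of n] by (simp add: N_def)
  have b2: "(N + 3)\<^sup>2 * b (Suc (Suc n))
      = (N + 2) * (2 * (N + 3) * (3 * a n + 6 * b n) + (7 * N + 18) * b (Suc n))"
    using b[of "Suc n"] by (simp add: N_def a add_ac)
  \<comment> \<open>\<open>L\<close> clears the denominators of all three values; being positive, it
    can be cancelled at the end.\<close>
  define L where "L = (N + 2)\<^sup>2 * (N + 3)\<^sup>2 * (N + 4)\<^sup>2 * (N + 5)\<^sup>2 * (N + 6)"
  have "L * u n = (N + 4) * (N + 5)\<^sup>2 * (N + 6) * ((N + 2)\<^sup>2 * (N + 3)\<^sup>2 * (N + 4) * u n)"
    unfolding L_def by algebra
  then have Lu0: "L * u n = (N + 4) * (N + 5)\<^sup>2 * (N + 6) * (P N * a n + Q N * b n)"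
    unfolding u0 .
  have "L * u (n + 1) = (N + 2)\<^sup>2 * (N + 5) * (N + 6) * ((N + 3)\<^sup>2 * (N + 4)\<^sup>2 * (N + 5) * u (n + 1))"
    unfolding L_def by algebra
  also have "\<dots> = (N + 5) * (N + 6) * (P (N + 1) * (N + 2)\<^sup>2 * (3 * a n + 6 * b n)
      + Q (N + 1) * ((N + 2)\<^sup>2 * b (Suc n)))"
    unfolding u1 by algebra
  finally have Lu1: "L * u (n + 1) = (N + 5) * (N + 6) * (P (N + 1) * (N + 2)\<^sup>2 * (3 * a n + 6 * b n)
      + Q (N + 1) * ((N + 1) * (2 * (N + 2) * a n + (7 * N + 11) * b n)))"
    unfolding b1 .
  have "L * u (n + 2) = (N + 2)\<^sup>2 * (N + 3)\<^sup>2 * ((N + 4)\<^sup>2 * (N + 5)\<^sup>2 * (N + 6) * u (n + 2))"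
    unfolding L_def by algebra
  also have "\<dots> = (N + 2)\<^sup>2 * (N + 3)\<^sup>2 * P (N + 2) * (9 * a n + 18 * b n)
      + 6 * (N + 3)\<^sup>2 * P (N + 2) * ((N + 2)\<^sup>2 * b (Suc n))
      + Q (N + 2) * (N + 2)\<^sup>2 * ((N + 3)\<^sup>2 * b (Suc (Suc n)))"
    unfolding u2 by algebra
  also have "\<dots> = (N + 2)\<^sup>2 * (N + 3)\<^sup>2 * P (N + 2) * (9 * a n + 18 * b n)
      + 6 * (N + 3)\<^sup>2 * P (N + 2) * ((N + 2)\<^sup>2 * b (Suc n))
      + Q (N + 2) * (N + 2) * ((N + 2)\<^sup>2 * (2 * (N + 3) * (3 * a n + 6 * b n)) + (7 * N + 18) * ((N + 2)\<^sup>2 * b (Suc n)))"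
    unfolding b2 by algebra
  finally have Lu2: "L * u (n + 2) = (N + 2)\<^sup>2 * (N + 3)\<^sup>2 * P (N + 2) * (9 * a n + 18 * b n)
      + 6 * (N + 3)\<^sup>2 * P (N + 2) * ((N + 1) * (2 * (N + 2) * a n + (7 * N + 11) * b n))
      + Q (N + 2) * (N + 2) * ((N + 2)\<^sup>2 * (2 * (N + 3) * (3 * a n + 6 * b n))
         + (7 * N + 18) * ((N + 1) * (2 * (N + 2) * a n + (7 * N + 11) * b n)))"
    unfolding b1 .
  have "L * (9 * (N + 1) * (N + 4) * u n
    - 2 * (5 * (N + 1)\<^sup>2 + 26 * (N + 1) + 30) * u (n + 1)
    + (N + 5) * (N + 6) * u (n + 2))
    = 9 * (N + 1) * (N + 4) * (L * u n)
    - 2 * (5 * (N + 1)\<^sup>2 + 26 * (N + 1) + 30) * (L * u (n + 1))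
    + (N + 5) * (N + 6) * (L * u (n + 2))"
    by algebra
  also have "\<dots> = 0"
    unfolding Lu0 Lu1 Lu2 P_def Q_def by algebra
  finally show ?thesis
    by (simp add: L_def N_def)
qed

section \<open>D-finiteness\<close>

text \<open>Differentiating a combination of 1, y and y' produces only y'' as a new term, which the
  equation removes at the cost of a factor \<open>q\<close>.\<close>

lemma higher_fps_deriv_as_combination:
  fixes y :: "rat fps" and q p0 p1 p2 :: "rat poly"
  assumes q: "q \<noteq> 0"
    and ode: "fps_of_poly q * fps_deriv (fps_deriv y) =
      fps_of_poly p0 + fps_of_poly p1 * y + fps_of_poly p2 * fps_deriv y"
  shows "\<exists>Q A B C. Q \<noteq> 0 \<and> fps_of_poly Q * (fps_deriv ^^ k) y =
      fps_of_poly A + fps_of_poly B * y + fps_of_poly C * fps_deriv y"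
proof (induction k)
  case 0
  show ?case
    by (rule exI[of _ 1], rule exI[of _ 0], rule exI[of _ 1], rule exI[of _ 0]) simp
next
  case (Suc k)
  then obtain Q A B C where Q: "Q \<noteq> 0" and eq: "fps_of_poly Q * (fps_deriv ^^ k) y =
      fps_of_poly A + fps_of_poly B * y + fps_of_poly C * fps_deriv y"
    by blast
  define z where "z = (fps_deriv ^^ k) y"
  have z: "fps_of_poly Q * z = fps_of_poly A + fps_of_poly B * y + fps_of_poly C * fps_deriv y"
    using eq by (simp add: z_def)
  have dz: "fps_deriv (fps_of_poly Q) * z + fps_of_poly Q * fps_deriv z
      = fps_deriv (fps_of_poly A) + fps_deriv (fps_of_poly B) * y + fps_of_poly B * fps_deriv y
        + fps_deriv (fps_of_poly C) * fps_deriv y + fps_of_poly C * fps_deriv (fps_deriv y)"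
    using arg_cong[OF z, of fps_deriv] by (simp add: algebra_simps)
  \<comment> \<open>The differentiated identity is multiplied by \<open>q * Q\<close>: one factor
    \<open>Q\<close> serves to replace \<open>Q * z\<close>, and \<open>q\<close> to replace
    y''.\<close>
  have "fps_of_poly (q * Q * Q) * fps_deriv z =
      fps_of_poly (q * Q * pderiv A + Q * C * p0 - q * pderiv Q * A)
      + fps_of_poly (q * Q * pderiv B + Q * C * p1 - q * pderiv Q * B) * y
      + fps_of_poly (q * Q * (B + pderiv C) + Q * C * p2 - q * pderiv Q * C) * fps_deriv y"
    unfolding fps_of_poly_mult fps_of_poly_add fps_of_poly_diff fps_of_poly_pderiv
    using z dz ode by algebra
  moreover have "q * Q * Q \<noteq> 0"
    using q Q by simp
  moreover have "fps_deriv z = (fps_deriv ^^ Suc k) y"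
    by (simp add: z_def)
  ultimately show ?case
    by metis
qed

text \<open>\<open>D_finite\<close> asks for a finite set with exactly the span of the derivatives.
  A maximal independent set of derivatives is one, since independent sets inside the span of
  \<open>F\<close> are finite.\<close>

lemma D_finiteI:
  assumes "finite F" and sub: "\<And>k. fps_to_fls ((fps_deriv ^^ k) y) \<in> ratfun.span F"
  shows "D_finite y"
proof -
  let ?V = "range (\<lambda>k. fps_to_fls ((fps_deriv ^^ k) y))"
  obtain B where B: "B \<subseteq> ?V" "ratfun.independent B" "?V \<subseteq> ratfun.span B"
    using ratfun.maximal_independent_subset by blast
  have "finite B"
    using ratfun.independent_span_bound[OF assms(1) B(2)] B(1) sub by blast
  moreover have "ratfun.span ?V = ratfun.span B"
    using B by (meson ratfun.span_eq ratfun.span_superset subset_trans)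
  ultimately show ?thesis
    unfolding D_finite_def by blast
qed

lemma D_finite_second_order:
  fixes y :: "rat fps" and q p0 p1 p2 :: "rat poly"
  assumes q: "q \<noteq> 0"
    and ode: "fps_of_poly q * fps_deriv (fps_deriv y) =
      fps_of_poly p0 + fps_of_poly p1 * y + fps_of_poly p2 * fps_deriv y"
  shows "D_finite y"
proof (rule D_finiteI)
  let ?F = "{1, fps_to_fls y, fps_to_fls (fps_deriv y)}"
  show "finite ?F"
    by simp
  fix k
  obtain Q A B C where Q: "Q \<noteq> 0" and eq: "fps_of_poly Q * (fps_deriv ^^ k) y =
      fps_of_poly A + fps_of_poly B * y + fps_of_poly C * fps_deriv y"
    using higher_fps_deriv_as_combination[OF assms] by blast
  let ?l = "\<lambda>p. fps_to_fls (fps_of_poly p)"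
  have "?l Q * fps_to_fls ((fps_deriv ^^ k) y)
      = ?l A + ?l B * fps_to_fls y + ?l C * fps_to_fls (fps_deriv y)"
    using arg_cong[OF eq, of fps_to_fls] by (simp add: fls_times_fps_to_fls)
  moreover have "?l Q \<noteq> 0"
    using Q by simp
  ultimately have "fps_to_fls ((fps_deriv ^^ k) y)
      = (?l A + ?l B * fps_to_fls y + ?l C * fps_to_fls (fps_deriv y)) / ?l Q"
    by (simp add: field_simps)
  also have "\<dots> = ratfun_scale (Fract A Q) 1 + ratfun_scale (Fract B Q) (fps_to_fls y)
      + ratfun_scale (Fract C Q) (fps_to_fls (fps_deriv y))"
    using Q by (simp add: ratfun_scale_def ratfun_to_fls_Fract add_divide_distrib)
  also have "\<dots> \<in> ratfun.span ?F"
    by (intro ratfun.span_add ratfun.span_scale ratfun.span_base) auto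
  finally show "fps_to_fls ((fps_deriv ^^ k) y) \<in> ratfun.span ?F" .
qed

text \<open>
  The inhomogeneous term \<open>6 - 6 x\<close> collects the initial coefficients that the recurrence does not reach.
\<close>

lemma fps_ode_of_recurrence:
  fixes c :: "nat \<Rightarrow> rat"
  assumes c0: "c 0 = 1" and c1: "c 1 = 1"
    and rec: "\<And>n. 9 * of_nat n * (of_nat n + 3) * c n - 2 * (5 * (of_nat n)\<^sup>2 + 26 * of_nat n + 30) * c (n + 1)
              + (of_nat n + 4) * (of_nat n + 5) * c (n + 2) = 0"
  defines "y \<equiv> Abs_fps c"
  shows "fps_of_poly [:0, 0, 1, - 10, 9:] * fps_deriv (fps_deriv y) =
      fps_of_poly [:6, - 6:] + fps_of_poly [:- 6, 18:] * y + fps_of_poly [:0, - 6, 42, - 36:] * fps_deriv y"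
proof -
  define k where "k = (fps_const :: rat \<Rightarrow> rat fps)"
  let ?D = "fps_deriv y" and ?DD = "fps_deriv (fps_deriv y)"
  have "fps_X * (fps_X * ?DD) + k (- 10) * (fps_X * (fps_X * (fps_X * ?DD))) + k 9 * (fps_X * (fps_X * (fps_X * (fps_X * ?DD))))
      = k 6 + k (- 6) * fps_X + k (- 6) * y + k 18 * (fps_X * y) + k (- 6) * (fps_X * ?D)
        + k 42 * (fps_X * (fps_X * ?D)) + k (- 36) * (fps_X * (fps_X * (fps_X * ?D)))" (is "?l = ?r")
  proof (rule fps_ext)
    fix n
    \<comment> \<open>The coefficient at \<open>n\<close> is the recurrence at \<open>n - 2\<close>.
      For \<open>n\<close> equal to 0 and 1 the initial values suffice; 2 and 3 are separate because
      some terms with several factors \<open>fps_X\<close> still vanish there.\<close>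
    consider "n = 0" | "n = Suc 0" | "n = Suc (Suc 0)" | "n = Suc (Suc (Suc 0))"
      | m where "n = Suc (Suc (Suc (Suc m)))"
      by (metis not0_implies_Suc)
    then show "?l $ n = ?r $ n"
    proof cases
      case 3 then show ?thesis
        using rec[of 0] c0 c1 by (simp add: k_def y_def)
    next
      case 4 then show ?thesis
        using rec[of 1] c0 c1 by (simp add: k_def y_def)
    next
      case (5 m)
      define c2 c3 c4 where "c2 = c (Suc (Suc m))" and "c3 = c (Suc (Suc (Suc m)))"
        and "c4 = c (Suc (Suc (Suc (Suc m))))"
      have "?l $ n = (of_nat m + 4) * (of_nat m + 3) * c4 - 10 * (of_nat m + 3) * (of_nat m + 2) * c3
          + 9 * (of_nat m + 2) * (of_nat m + 1) * c2"
        by (simp add: 5 c2_def c3_def c4_def k_def y_def algebra_simps)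
      moreover have "?r $ n = - 6 * c4 + 18 * c3 - 6 * (of_nat m + 4) * c4
          + 42 * (of_nat m + 3) * c3 - 36 * (of_nat m + 2) * c2"
        by (simp add: 5 c2_def c3_def c4_def k_def y_def algebra_simps)
      moreover have "9 * (of_nat m + 2) * (of_nat m + 5) * c2
          - 2 * (5 * (of_nat m + 2)\<^sup>2 + 26 * (of_nat m + 2) + 30) * c3
          + (of_nat m + 6) * (of_nat m + 7) * c4 = 0"
        using rec[of "Suc (Suc m)"] by (simp add: c2_def c3_def c4_def algebra_simps)
      ultimately show ?thesis
        by algebra
    qed (simp_all add: k_def y_def c0 c1[simplified])
  qed
  moreover have k: "k 0 = 0" "k 1 = 1"
    by (simp_all add: k_def)
  have "fps_of_poly [:0, 0, 1, - 10, 9:] * ?DD = ?l"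
    unfolding fps_of_poly_pCons fps_of_poly_0 k_def[symmetric] k by (simp add: algebra_simps)
  moreover have "fps_of_poly [:6, - 6:] + fps_of_poly [:- 6, 18:] * y + fps_of_poly [:0, - 6, 42, - 36:] * ?D = ?r"
    unfolding fps_of_poly_pCons fps_of_poly_0 k_def[symmetric] k by (simp add: algebra_simps)
  ultimately show ?thesis
    by simp
qed

section \<open>Coloured arc diagrams\<close>

text \<open>
  Partial diagrams: \<open>(i, j, c)\<close> is an arc of colour \<open>c\<close> from \<open>i \<le> l\<close> to \<open>j \<le> r\<close>. Arcs that are still open
  end in the common sentinel \<open>N\<close>, which lies to the right of all vertices, so that the crossing
  condition for closed arcs also tells which open arcs can be closed.
\<close>

definition arc_configs :: "nat \<Rightarrow> nat \<Rightarrow> nat \<Rightarrow> (nat \<times> nat \<times> nat) set set" where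
  "arc_configs N l r = {X. X \<subseteq> {1..l} \<times> ({1..r} \<union> {N}) \<times> {1, 2} \<and>
     (\<forall>i j c. (i, j, c) \<in> X \<longrightarrow> i < j) \<and>
     (\<forall>i j c j' c'. (i, j, c) \<in> X \<longrightarrow> (i, j', c') \<in> X \<longrightarrow> j = j' \<and> c = c') \<and>
     (\<forall>i j c i' c'. (i, j, c) \<in> X \<longrightarrow> (i', j, c') \<in> X \<longrightarrow> j \<noteq> N \<longrightarrow> i = i') \<and>
     (\<forall>i j i' j' c. (i, j, c) \<in> X \<longrightarrow> (i', j', c) \<in> X \<longrightarrow> \<not> (i < i' \<and> i' < j \<and> j < j'))}"

definition open_arcs :: "nat \<Rightarrow> (nat \<times> nat \<times> nat) set \<Rightarrow> nat \<Rightarrow> nat set" where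
  "open_arcs N X c = {i. (i, N, c) \<in> X}"

definition arc_states :: "nat \<Rightarrow> nat \<Rightarrow> nat \<Rightarrow> (nat \<Rightarrow> nat) \<Rightarrow> (nat \<times> nat \<times> nat) set set" where
  "arc_states N l r k = {X \<in> arc_configs N l r. \<forall>c\<in>{1, 2}. card (open_arcs N X c) = k c}"

lemma arc_configsI:
  assumes "\<And>i j c. (i, j, c) \<in> X \<Longrightarrow> 1 \<le> i \<and> i \<le> l \<and> (1 \<le> j \<and> j \<le> r \<or> j = N) \<and> (c = 1 \<or> c = 2) \<and> i < j"
    and "\<And>i j c j' c'. (i, j, c) \<in> X \<Longrightarrow> (i, j', c') \<in> X \<Longrightarrow> j = j' \<and> c = c'"
    and "\<And>i j c i' c'. (i, j, c) \<in> X \<Longrightarrow> (i', j, c') \<in> X \<Longrightarrow> j \<noteq> N \<Longrightarrow> i = i'"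
    and "\<And>i j i' j' c. (i, j, c) \<in> X \<Longrightarrow> (i', j', c) \<in> X \<Longrightarrow> \<not> (i < i' \<and> i' < j \<and> j < j')"
  shows "X \<in> arc_configs N l r"
proof -
  have "x \<in> {1..l} \<times> ({1..r} \<union> {N}) \<times> {1, 2}" if "x \<in> X" for x
  proof -
    obtain i j c where x: "x = (i, j, c)" by (cases x)
    show ?thesis using assms(1)[OF that[unfolded x]] by (auto simp: x)
  qed
  then have "X \<subseteq> {1..l} \<times> ({1..r} \<union> {N}) \<times> {1, 2}"
    by (rule subsetI)
  moreover have "\<forall>i j c. (i, j, c) \<in> X \<longrightarrow> i < j"
    using assms(1) by blast
  moreover have "\<forall>i j c j' c'. (i, j, c) \<in> X \<longrightarrow> (i, j', c') \<in> X \<longrightarrow> j = j' \<and> c = c'"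
    using assms(2) by blast
  moreover have "\<forall>i j c i' c'. (i, j, c) \<in> X \<longrightarrow> (i', j, c') \<in> X \<longrightarrow> j \<noteq> N \<longrightarrow> i = i'"
    using assms(3) by blast
  moreover have "\<forall>i j i' j' c. (i, j, c) \<in> X \<longrightarrow> (i', j', c) \<in> X \<longrightarrow> \<not> (i < i' \<and> i' < j \<and> j < j')"
    using assms(4) by blast
  ultimately show ?thesis
    unfolding arc_configs_def by (intro CollectI conjI)
qed

lemma arc_configsD:
  assumes "X \<in> arc_configs N l r"
  shows "(i, j, c) \<in> X \<Longrightarrow> 1 \<le> i \<and> i \<le> l \<and> (1 \<le> j \<and> j \<le> r \<or> j = N) \<and> (c = 1 \<or> c = 2) \<and> i < j"
    and "(i, j, c) \<in> X \<Longrightarrow> (i, j', c') \<in> X \<Longrightarrow> j = j' \<and> c = c'"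
    and "(i, j, c) \<in> X \<Longrightarrow> (i', j, c') \<in> X \<Longrightarrow> j \<noteq> N \<Longrightarrow> i = i'"
    and "(i, j, c) \<in> X \<Longrightarrow> (i', j', c) \<in> X \<Longrightarrow> \<not> (i < i' \<and> i' < j \<and> j < j')"
proof -
  have sub: "X \<subseteq> {1..l} \<times> ({1..r} \<union> {N}) \<times> {1, 2}"
    and X: "\<forall>i j c. (i, j, c) \<in> X \<longrightarrow> i < j"
      "\<forall>i j c j' c'. (i, j, c) \<in> X \<longrightarrow> (i, j', c') \<in> X \<longrightarrow> j = j' \<and> c = c'"
      "\<forall>i j c i' c'. (i, j, c) \<in> X \<longrightarrow> (i', j, c') \<in> X \<longrightarrow> j \<noteq> N \<longrightarrow> i = i'"
      "\<forall>i j i' j' c. (i, j, c) \<in> X \<longrightarrow> (i', j', c) \<in> X \<longrightarrow> \<not> (i < i' \<and> i' < j \<and> j < j')"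
    using assms unfolding arc_configs_def by blast+
  show "1 \<le> i \<and> i \<le> l \<and> (1 \<le> j \<and> j \<le> r \<or> j = N) \<and> (c = 1 \<or> c = 2) \<and> i < j" if "(i, j, c) \<in> X"
    using subsetD[OF sub that] X(1) that by auto
  show "j = j' \<and> c = c'" if "(i, j, c) \<in> X" "(i, j', c') \<in> X"
    using X(2) that by blast
  show "i = i'" if "(i, j, c) \<in> X" "(i', j, c') \<in> X" "j \<noteq> N"
    using X(3) that by blast
  show "\<not> (i < i' \<and> i' < j \<and> j < j')" if "(i, j, c) \<in> X" "(i', j', c) \<in> X"
    using X(4) that by blast
qed

lemma arc_configs_subset:
  assumes X: "X \<in> arc_configs N l r" and sub: "Y \<subseteq> X"
    and bound: "\<And>i j c. (i, j, c) \<in> Y \<Longrightarrow> i \<le> l' \<and> (j \<le> r' \<or> j = N)"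
  shows "Y \<in> arc_configs N l' r'"
proof (rule arc_configsI)
  note D = arc_configsD[OF X, OF subsetD[OF sub]]
  show "1 \<le> i \<and> i \<le> l' \<and> (1 \<le> j \<and> j \<le> r' \<or> j = N) \<and> (c = 1 \<or> c = 2) \<and> i < j"
    if "(i, j, c) \<in> Y" for i j c
    using D(1)[OF that] bound[OF that] by linarith
  show "j = j' \<and> c = c'" if "(i, j, c) \<in> Y" "(i, j', c') \<in> Y" for i j c j' c'
    using D(2)[OF that(1) subsetD[OF sub that(2)]] .
  show "i = i'" if "(i, j, c) \<in> Y" "(i', j, c') \<in> Y" "j \<noteq> N" for i j c i' c'
    using D(3)[OF that(1) subsetD[OF sub that(2)] that(3)] .
  show "\<not> (i < i' \<and> i' < j \<and> j < j')" if "(i, j, c) \<in> Y" "(i', j', c) \<in> Y" for i j i' j' c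
    using D(4)[OF that(1) subsetD[OF sub that(2)]] .
qed

lemma finite_arc_configs: "finite (arc_configs N l r)"
proof (rule finite_subset)
  show "arc_configs N l r \<subseteq> Pow ({1..l} \<times> ({1..r} \<union> {N}) \<times> {1, 2})"
    unfolding arc_configs_def by blast
qed simp

lemma finite_arc_states: "finite (arc_states N l r k)"
  using finite_arc_configs by (simp add: arc_states_def)

lemma finite_open_arcs: "X \<in> arc_configs N l r \<Longrightarrow> finite (open_arcs N X c)"
proof (rule finite_subset[of _ "{1..l}"])
  assume "X \<in> arc_configs N l r"
  from arc_configsD(1)[OF this, of _ N c] show "open_arcs N X c \<subseteq> {1..l}"
    by (auto simp: open_arcs_def)
qed simp

lemma arc_states_0:
  "arc_states N 0 r k = (if k 1 = 0 \<and> k 2 = 0 then {{}} else {})"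
proof -
  have "arc_configs N 0 r = {{}}"
    by (auto simp: arc_configs_def)
  then have "X \<in> arc_states N 0 r k \<longleftrightarrow> X = {} \<and> k 1 = 0 \<and> k 2 = 0" for X
    unfolding arc_states_def by (cases "X = {}") (simp_all add: open_arcs_def)
  then show ?thesis
    by (intro set_eqI) (simp only: split: if_split, blast)
qed

section \<open>Opening and closing an arc\<close>

text \<open>An open arc at the new rightmost start never creates a crossing: no arc starts after it,
  and by \<open>r \<le> Suc l\<close> every closed arc ends no later than its start.\<close>

lemma open_arc_bij:
  assumes N: "r \<le> Suc l" "Suc l < N" "r < N" and c: "c \<in> {1, 2}" and k: "k c > 0"
  shows "bij_betw (insert (Suc l, N, c)) (arc_states N l r (k(c := k c - 1)))
     {X \<in> arc_states N (Suc l) r k. (Suc l, N, c) \<in> X}"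
proof (rule bij_betw_byWitness[where f' = "\<lambda>X. X - {(Suc l, N, c)}"])
  have new: "(Suc l, j, c') \<notin> X" if "X \<in> arc_configs N l r" for X j c'
    using arc_configsD(1)[OF that] by fastforce
  show "\<forall>X\<in>arc_states N l r (k(c := k c - 1)). insert (Suc l, N, c) X - {(Suc l, N, c)} = X"
    using new by (auto simp: arc_states_def)
  show "\<forall>X\<in>{X \<in> arc_states N (Suc l) r k. (Suc l, N, c) \<in> X}. insert (Suc l, N, c) (X - {(Suc l, N, c)}) = X"
    by auto
  show "insert (Suc l, N, c) ` arc_states N l r (k(c := k c - 1)) \<subseteq> {X \<in> arc_states N (Suc l) r k. (Suc l, N, c) \<in> X}"
  proof clarify
    fix X assume "X \<in> arc_states N l r (k(c := k c - 1))"
    then have X: "X \<in> arc_configs N l r" and card: "\<And>d. d \<in> {1, 2} \<Longrightarrow> card (open_arcs N X d) = (k(c := k c - 1)) d"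
      by (auto simp: arc_states_def)
    note D = arc_configsD[OF X]
    have "insert (Suc l, N, c) X \<in> arc_configs N (Suc l) r"
    proof (rule arc_configsI)
      fix i j c' assume "(i, j, c') \<in> insert (Suc l, N, c) X"
      then show "1 \<le> i \<and> i \<le> Suc l \<and> (1 \<le> j \<and> j \<le> r \<or> j = N) \<and> (c' = 1 \<or> c' = 2) \<and> i < j"
        using D(1)[of i j c'] N c by auto
    next
      fix i j c' j' d
      assume "(i, j, c') \<in> insert (Suc l, N, c) X" "(i, j', d) \<in> insert (Suc l, N, c) X"
      then show "j = j' \<and> c' = d"
        using D(2)[of i j c' j' d] new[OF X] by auto
    next
      fix i j c' i' d
      assume "(i, j, c') \<in> insert (Suc l, N, c) X" "(i', j, d) \<in> insert (Suc l, N, c) X" "j \<noteq> N"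
      then show "i = i'"
        using D(3)[of i j c' i' d] by auto
    next
      fix i j i' j' d
      assume "(i, j, d) \<in> insert (Suc l, N, c) X" "(i', j', d) \<in> insert (Suc l, N, c) X"
      then show "\<not> (i < i' \<and> i' < j \<and> j < j')"
        using D(1)[of i j d] D(1)[of i' j' d] D(4)[of i j d i' j'] N by auto
    qed
    moreover have "open_arcs N (insert (Suc l, N, c) X) d = (if d = c then insert (Suc l) (open_arcs N X d) else open_arcs N X d)" for d
      by (auto simp: open_arcs_def)
    moreover have "Suc l \<notin> open_arcs N X c"
      using new[OF X] by (auto simp: open_arcs_def)
    ultimately show "insert (Suc l, N, c) X \<in> arc_states N (Suc l) r k \<and> (Suc l, N, c) \<in> insert (Suc l, N, c) X"
      using card[of 1] card[of 2] k c finite_open_arcs[OF X, of c] by (auto simp: arc_states_def)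
  qed
  show "(\<lambda>X. X - {(Suc l, N, c)}) ` {X \<in> arc_states N (Suc l) r k. (Suc l, N, c) \<in> X} \<subseteq> arc_states N l r (k(c := k c - 1))"
  proof clarify
    fix X assume X': "X \<in> arc_states N (Suc l) r k" and m: "(Suc l, N, c) \<in> X"
    then have X: "X \<in> arc_configs N (Suc l) r" and card: "\<And>d. d \<in> {1, 2} \<Longrightarrow> card (open_arcs N X d) = k d"
      by (auto simp: arc_states_def)
    note D = arc_configsD[OF X]
    have "X - {(Suc l, N, c)} \<in> arc_configs N l r"
    proof (rule arc_configs_subset[OF X])
      fix i j c' assume "(i, j, c') \<in> X - {(Suc l, N, c)}"
      then show "i \<le> l \<and> (j \<le> r \<or> j = N)"
        using D(1)[of i j c'] D(2)[OF m, of j c'] by (cases "i = Suc l") auto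
    qed blast
    moreover have "open_arcs N (X - {(Suc l, N, c)}) d = (if d = c then open_arcs N X d - {Suc l} else open_arcs N X d)" for d
      by (auto simp: open_arcs_def)
    moreover have "Suc l \<in> open_arcs N X c"
      using m by (auto simp: open_arcs_def)
    ultimately show "X - {(Suc l, N, c)} \<in> arc_states N l r (k(c := k c - 1))"
      using card[of 1] card[of 2] k c finite_open_arcs[OF X, of c] by (auto simp: arc_states_def)
  qed
qed

text \<open>The cases are: no arc starts at \<open>Suc l\<close>, or one of colour 1 or 2 does. The
  guards \<open>k c = 0\<close> exclude truncated subtraction, since a diagram with a new open arc
  has a positive count.\<close>

lemma card_arc_states_open:
  assumes N: "r \<le> Suc l" "Suc l < N" "r < N"
  shows "card (arc_states N (Suc l) r k) = card (arc_states N l r k)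
    + (if k 1 = 0 then 0 else card (arc_states N l r (k(1 := k 1 - 1))))
    + (if k 2 = 0 then 0 else card (arc_states N l r (k(2 := k 2 - 1))))"
proof -
  define B where "B c = {X \<in> arc_states N (Suc l) r k. (Suc l, N, c) \<in> X}" for c
  have cB: "card (B c) = (if k c = 0 then 0 else card (arc_states N l r (k(c := k c - 1))))" if "c \<in> {1, 2}" for c
  proof (cases "k c = 0")
    case True
    have "B c = {}"
    proof (rule ccontr)
      assume "B c \<noteq> {}"
      then obtain X where X: "X \<in> arc_configs N (Suc l) r" "\<forall>c\<in>{1, 2}. card (open_arcs N X c) = k c"
          "Suc l \<in> open_arcs N X c"
        by (auto simp: B_def arc_states_def open_arcs_def)
      then have "card (open_arcs N X c) = 0"
        using that True by metis
      then show False
        using finite_open_arcs[OF X(1), of c] X(3) by auto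
    qed
    then show ?thesis using True by simp
  next
    case False
    then show ?thesis
      using bij_betw_same_card[OF open_arc_bij[OF N that, of k]] by (simp add: B_def)
  qed
  have split: "arc_states N (Suc l) r k = arc_states N l r k \<union> B 1 \<union> B 2"
  proof (intro equalityI subsetI)
    fix X assume X: "X \<in> arc_states N (Suc l) r k"
    then have XX: "X \<in> arc_configs N (Suc l) r" by (simp add: arc_states_def)
    note D = arc_configsD[OF XX]
    show "X \<in> arc_states N l r k \<union> B 1 \<union> B 2"
    proof (cases "\<exists>j c. (Suc l, j, c) \<in> X")
      case True
      then obtain j c where jc: "(Suc l, j, c) \<in> X" by blast
      \<comment> \<open>An arc starting at \<open>Suc l\<close> cannot end at a vertex up to
        \<open>r\<close>, so it is open.\<close>
      from D(1)[OF jc] N have "j = N" "c = 1 \<or> c = 2" by auto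
      with jc X show ?thesis unfolding B_def by blast
    next
      case False
      then have "X \<in> arc_configs N l r"
        by (intro arc_configs_subset[OF XX order_refl]) (metis D(1) le_Suc_eq)
      then show ?thesis using X by (simp add: arc_states_def)
    qed
  next
    fix X assume "X \<in> arc_states N l r k \<union> B 1 \<union> B 2"
    moreover have "X \<in> arc_states N (Suc l) r k" if X: "X \<in> arc_states N l r k"
    proof -
      from X have XX: "X \<in> arc_configs N l r" by (simp add: arc_states_def)
      have "X \<in> arc_configs N (Suc l) r"
        by (intro arc_configs_subset[OF XX order_refl]) (metis arc_configsD(1)[OF XX] le_SucI)
      then show ?thesis using X by (simp add: arc_states_def)
    qed
    ultimately show "X \<in> arc_states N (Suc l) r k"
      unfolding B_def by blast
  qed
  have "arc_states N l r k \<inter> B c = {}" for c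
  proof -
    have "(Suc l, N, c) \<notin> X" if "X \<in> arc_configs N l r" for X
      using arc_configsD(1)[OF that, of "Suc l" N c] by auto
    then show ?thesis
      by (auto simp: B_def arc_states_def)
  qed
  moreover have "B 1 \<inter> B 2 = {}"
  proof -
    have "(Suc l, N, 2) \<notin> X" if "X \<in> arc_configs N (Suc l) r" "(Suc l, N, 1) \<in> X" for X
      using arc_configsD(2)[OF that, of N 2] by auto
    then show ?thesis
      by (auto simp: B_def arc_states_def)
  qed
  moreover have "finite (B c)" for c
    unfolding B_def using finite_arc_states by simp
  ultimately have "card (arc_states N (Suc l) r k) = card (arc_states N l r k) + card (B 1) + card (B 2)"
    by (simp add: split card_Un_disjoint finite_arc_states Int_Un_distrib2)
  then show ?thesis
    by (simp only: cB insert_iff simp_thms)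
qed

text \<open>Only the open arc with the largest start may be closed, as an open arc of the same
  colour starting later would cross it. The inverse \<open>g\<close> sends the arc ending at
  \<open>Suc r\<close> back to the sentinel.\<close>

lemma close_arc_bij:
  assumes N: "l \<le> r" "Suc r < N" and c: "c \<in> {1, 2}"
  shows "bij_betw (\<lambda>X. insert (Max (open_arcs N X c), Suc r, c) (X - {(Max (open_arcs N X c), N, c)}))
     (arc_states N l r (k(c := k c + 1)))
     {Y \<in> arc_states N l (Suc r) k. \<exists>i. (i, Suc r, c) \<in> Y}"
    (is "bij_betw ?f ?A ?B")
proof -
  define g where "g Y = (let i = (THE i. (i, Suc r, c) \<in> Y) in insert (i, N, c) (Y - {(i, Suc r, c)}))"
    for Y :: "(nat \<times> nat \<times> nat) set"
  have fA: "?f X \<in> ?B \<and> g (?f X) = X" if "X \<in> ?A" for X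
  proof -
    define m where "m = Max (open_arcs N X c)"
    from that have X: "X \<in> arc_configs N l r"
      and card: "\<And>d. d \<in> {1, 2} \<Longrightarrow> card (open_arcs N X d) = (k(c := k c + 1)) d"
      by (auto simp: arc_states_def)
    note D = arc_configsD[OF X] and fin = finite_open_arcs[OF X]
    have "card (open_arcs N X c) \<noteq> 0"
      using card[OF c] by simp
    then have ne: "open_arcs N X c \<noteq> {}"
      by auto
    have m: "(m, N, c) \<in> X"
      using Max_in[OF fin ne] by (simp add: m_def open_arcs_def)
    have max: "i \<le> m" if "(i, N, c) \<in> X" for i
      using Max_ge[OF fin, of i c] that by (simp add: m_def open_arcs_def)
    have new: "(i, Suc r, d) \<notin> X" for i d
      using D(1)[of i "Suc r" d] N by auto
    define Y where "Y = insert (m, Suc r, c) (X - {(m, N, c)})"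
    have fX: "?f X = Y"
      by (simp add: Y_def m_def)
    have Y: "(i, j, d) \<in> Y \<longleftrightarrow> i = m \<and> j = Suc r \<and> d = c \<or> (i, j, d) \<in> X \<and> (i, j, d) \<noteq> (m, N, c)" for i j d
      by (auto simp: Y_def)
    have mX: "j = N \<and> d = c" if "(m, j, d) \<in> X" for j d
      using D(2)[OF that m] .
    have "Y \<in> arc_configs N l (Suc r)"
    proof (rule arc_configsI)
      fix i j d assume "(i, j, d) \<in> Y"
      then show "1 \<le> i \<and> i \<le> l \<and> (1 \<le> j \<and> j \<le> Suc r \<or> j = N) \<and> (d = 1 \<or> d = 2) \<and> i < j"
        using D(1)[of i j d] D(1)[OF m] N unfolding Y by auto
    next
      fix i j d j' d' assume "(i, j, d) \<in> Y" "(i, j', d') \<in> Y"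
      then show "j = j' \<and> d = d'"
        using D(2)[of i j d j' d'] mX[of j d] mX[of j' d'] unfolding Y by auto
    next
      fix i j d i' d' assume "(i, j, d) \<in> Y" "(i', j, d') \<in> Y" "j \<noteq> N"
      then show "i = i'"
        using D(3)[of i j d i' d'] new unfolding Y by auto
    next
      fix i j i' j' d assume ij: "(i, j, d) \<in> Y" and ij': "(i', j', d) \<in> Y"
      show "\<not> (i < i' \<and> i' < j \<and> j < j')"
      proof
        assume less: "i < i' \<and> i' < j \<and> j < j'"
        consider "(i, j, d) \<in> X" "(i', j', d) \<in> X"
          | "(i, j, d) \<in> X" "i' = m" "j' = Suc r" "d = c"
          | "i = m" "j = Suc r" "d = c" "(i', j', d) \<in> X"
          | "j = Suc r" "j' = Suc r"
          using ij ij' unfolding Y by blast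
        then show False
        proof cases
          case 1 then show ?thesis using D(4) less by blast
        next
          \<comment> \<open>An old arc crossing the newly closed arc would already have crossed it
            when it still ended at the sentinel.\<close>
          case 2
          then have "j < N" using less N by simp
          then show ?thesis using D(4)[OF 2(1), of i' N] m 2 less by blast
        next
          \<comment> \<open>An arc crossed by the newly closed one must be open with a start beyond
            \<open>m\<close>, against maximality.\<close>
          case 3
          then have "j' = N" using D(1)[of i' j' d] less by auto
          then show ?thesis using max[of i'] 3 less by auto
        next
          case 4 then show ?thesis using less by auto
        qed
      qed
    qed
    moreover have "card (open_arcs N Y d) = k d" if "d \<in> {1, 2}" for d
    proof -
      have "open_arcs N Y d = (if d = c then open_arcs N X d - {m} else open_arcs N X d)"
        using N by (auto simp: open_arcs_def Y)
      moreover have "m \<in> open_arcs N X c"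
        using m by (simp add: open_arcs_def)
      ultimately show ?thesis
        using card[OF that] fin[of c] by (cases "d = c") simp_all
    qed
    ultimately have "Y \<in> arc_states N l (Suc r) k"
      unfolding arc_states_def by blast
    moreover have "(m, Suc r, c) \<in> Y"
      by (simp add: Y_def)
    moreover have "(THE i. (i, Suc r, c) \<in> Y) = m"
      using new N by (intro the_equality) (auto simp: Y)
    then have "g Y = X"
      using new m N by (auto simp: g_def Y_def)
    ultimately show ?thesis
      unfolding fX by blast
  qed
  have gB: "g Y \<in> ?A \<and> ?f (g Y) = Y" if "Y \<in> ?B" for Y
  proof -
    from that obtain m where Y: "Y \<in> arc_configs N l (Suc r)"
      and card: "\<And>d. d \<in> {1, 2} \<Longrightarrow> card (open_arcs N Y d) = k d" and m: "(m, Suc r, c) \<in> Y"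
      by (auto simp: arc_states_def)
    note D = arc_configsD[OF Y] and fin = finite_open_arcs[OF Y]
    have uniq: "i = m" if "(i, Suc r, d) \<in> Y" for i d
      using D(3)[OF that m] N by simp
    have mY: "j = Suc r \<and> d = c" if "(m, j, d) \<in> Y" for j d
      using D(2)[OF that m] .
    define X where "X = insert (m, N, c) (Y - {(m, Suc r, c)})"
    have "(THE i. (i, Suc r, c) \<in> Y) = m"
      using m uniq by blast
    then have gY: "g Y = X"
      by (simp add: g_def X_def)
    have X: "(i, j, d) \<in> X \<longleftrightarrow> i = m \<and> j = N \<and> d = c \<or> (i, j, d) \<in> Y \<and> (i, j, d) \<noteq> (m, Suc r, c)" for i j d
      by (auto simp: X_def)
    have "X \<in> arc_configs N l r"
    proof (rule arc_configsI)
      fix i j d assume ij: "(i, j, d) \<in> X"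
      have "j \<noteq> Suc r"
      proof
        assume j: "j = Suc r"
        then have "(i, Suc r, d) \<in> Y" "(i, Suc r, d) \<noteq> (m, Suc r, c)"
          using ij N unfolding X by auto
        then show False
          using uniq mY by blast
      qed
      then show "1 \<le> i \<and> i \<le> l \<and> (1 \<le> j \<and> j \<le> r \<or> j = N) \<and> (d = 1 \<or> d = 2) \<and> i < j"
        using D(1)[of i j d] D(1)[OF m] N ij unfolding X by auto
    next
      fix i j d j' d' assume "(i, j, d) \<in> X" "(i, j', d') \<in> X"
      then show "j = j' \<and> d = d'"
        using D(2)[of i j d j' d'] mY[of j d] mY[of j' d'] unfolding X by auto
    next
      fix i j d i' d' assume "(i, j, d) \<in> X" "(i', j, d') \<in> X" "j \<noteq> N"
      then show "i = i'"
        using D(3)[of i j d i' d'] unfolding X by auto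
    next
      fix i j i' j' d assume ij: "(i, j, d) \<in> X" and ij': "(i', j', d) \<in> X"
      show "\<not> (i < i' \<and> i' < j \<and> j < j')"
      proof
        assume less: "i < i' \<and> i' < j \<and> j < j'"
        consider "(i, j, d) \<in> Y" "(i', j', d) \<in> Y"
          | "(i, j, d) \<in> Y" "(i, j, d) \<noteq> (m, Suc r, c)" "i' = m" "j' = N" "d = c"
          | "i = m" "j = N" "d = c" "(i', j', d) \<in> Y"
          | "j = N" "j' = N"
          using ij ij' unfolding X by blast
        then show False
        proof cases
          case 1 then show ?thesis using D(4) less by blast
        next
          case 2
          have "j \<noteq> Suc r" using uniq[of i d] 2 by auto
          then have "j < Suc r" using D(1)[OF 2(1)] less 2 by auto
          then show ?thesis using D(4)[OF 2(1), of i' "Suc r"] m 2 less by blast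
        next
          case 3
          then show ?thesis using D(1)[OF 3(4)] less N by auto
        next
          case 4 then show ?thesis using less by auto
        qed
      qed
    qed
    moreover
    have op: "open_arcs N X d = (if d = c then insert m (open_arcs N Y d) else open_arcs N Y d)" for d
      using N by (auto simp: open_arcs_def X)
    have "card (open_arcs N X d) = (k(c := k c + 1)) d" if "d \<in> {1, 2}" for d
    proof -
      have "m \<notin> open_arcs N Y c"
        using mY[of N c] N by (auto simp: open_arcs_def)
      then show ?thesis
        using op[of d] card[OF that] fin[of c] by (cases "d = c") simp_all
    qed
    ultimately have "X \<in> ?A"
      unfolding arc_states_def by blast
    moreover have "Max (open_arcs N X c) = m"
    proof (rule Max_eqI)
      show "finite (open_arcs N X c)" "m \<in> open_arcs N X c"
        using op[of c] fin by simp_all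
      fix i assume "i \<in> open_arcs N X c"
      then have "i = m \<or> (i, N, c) \<in> Y"
        unfolding op by (auto simp: open_arcs_def)
      \<comment> \<open>By \<open>l \<le> r\<close> the start \<open>i\<close> lies before
        \<open>Suc r\<close>, so such an open arc would cross the closed arc of \<open>Y\<close>
        from \<open>m\<close> to \<open>Suc r\<close>.\<close>
      moreover have False if "(i, N, c) \<in> Y" "m < i"
        using D(4)[OF m that(1)] D(1)[OF that(1)] that(2) N by auto
      ultimately show "i \<le> m"
        using not_less by blast
    qed
    then have "?f X = Y"
      using m mY[of N c] N by (auto simp: X_def)
    ultimately show ?thesis
      unfolding gY by blast
  qed
  show ?thesis
  proof (rule bij_betw_byWitness[where f' = g])
    show "\<forall>X\<in>?A. g (?f X) = X" "\<forall>Y\<in>?B. ?f (g Y) = Y"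
      by (intro ballI conjunct2[OF fA] conjunct2[OF gB], assumption)+
    show "?f ` ?A \<subseteq> ?B" "g ` ?B \<subseteq> ?A"
      by (intro image_subsetI conjunct1[OF fA] conjunct1[OF gB], assumption)+
  qed
qed

lemma card_arc_states_close:
  assumes N: "l \<le> r" "Suc r < N"
  shows "card (arc_states N l (Suc r) k) = card (arc_states N l r k)
    + card (arc_states N l r (k(1 := k 1 + 1))) + card (arc_states N l r (k(2 := k 2 + 1)))"
proof -
  define B where "B c = {Y \<in> arc_states N l (Suc r) k. \<exists>i. (i, Suc r, c) \<in> Y}" for c
  have cB: "card (B c) = card (arc_states N l r (k(c := k c + 1)))" if "c \<in> {1, 2}" for c
    unfolding B_def by (rule bij_betw_same_card[OF close_arc_bij[OF N that], symmetric])
  have split: "arc_states N l (Suc r) k = arc_states N l r k \<union> B 1 \<union> B 2"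
  proof (intro equalityI subsetI)
    fix X assume X: "X \<in> arc_states N l (Suc r) k"
    then have XX: "X \<in> arc_configs N l (Suc r)" by (simp add: arc_states_def)
    note D = arc_configsD[OF XX]
    show "X \<in> arc_states N l r k \<union> B 1 \<union> B 2"
    proof (cases "\<exists>i c. (i, Suc r, c) \<in> X")
      case True
      then obtain i c where ic: "(i, Suc r, c) \<in> X" by blast
      from D(1)[OF ic] have "c = 1 \<or> c = 2" by auto
      with ic X show ?thesis unfolding B_def by blast
    next
      case False
      then have "X \<in> arc_configs N l r"
        by (intro arc_configs_subset[OF XX order_refl]) (metis D(1) le_Suc_eq)
      then show ?thesis using X by (simp add: arc_states_def)
    qed
  next
    fix X assume "X \<in> arc_states N l r k \<union> B 1 \<union> B 2"
    moreover have "X \<in> arc_states N l (Suc r) k" if X: "X \<in> arc_states N l r k"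
    proof -
      from X have XX: "X \<in> arc_configs N l r" by (simp add: arc_states_def)
      have "X \<in> arc_configs N l (Suc r)"
        by (intro arc_configs_subset[OF XX order_refl]) (metis arc_configsD(1)[OF XX] le_SucI)
      then show ?thesis using X by (simp add: arc_states_def)
    qed
    ultimately show "X \<in> arc_states N l (Suc r) k"
      unfolding B_def by blast
  qed
  have "arc_states N l r k \<inter> B c = {}" for c
  proof -
    have "(i, Suc r, c) \<notin> X" if "X \<in> arc_configs N l r" for X i
      using arc_configsD(1)[OF that, of i "Suc r" c] N by auto
    then show ?thesis
      by (auto simp: B_def arc_states_def)
  qed
  moreover have "B 1 \<inter> B 2 = {}"
  proof -
    have "(i', Suc r, 2) \<notin> X" if X: "X \<in> arc_configs N l (Suc r)" "(i, Suc r, 1) \<in> X" for X i i'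
    proof
      assume *: "(i', Suc r, 2) \<in> X"
      then have "i' = i" using arc_configsD(3)[OF X(1) *  X(2)] N by simp
      then show False using arc_configsD(2)[OF X, of "Suc r" 2] * by simp
    qed
    then show ?thesis
      by (auto simp: B_def arc_states_def)
  qed
  moreover have "finite (B c)" for c
    unfolding B_def using finite_arc_states by simp
  ultimately have "card (arc_states N l (Suc r) k) = card (arc_states N l r k) + card (B 1) + card (B 2)"
    by (simp add: split card_Un_disjoint finite_arc_states Int_Un_distrib2)
  then show ?thesis
    by (simp only: cB insert_iff simp_thms)
qed

text \<open>
  The step from \<open>m\<close> to \<open>m + 1\<close> opens an arc at vertex \<open>m + 1\<close> and then closes one at \<open>m + 2\<close>. In this
  order a step that opens and closes the same colour is always possible, so that standing still has
  weight \<open>3\<close> on the walls as well.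
\<close>

lemma card_arc_states_eq_chamber_walks:
  assumes "Suc m < N"
  shows "int (card (arc_states N m (Suc m) k)) = chamber_walks m (int (k 1)) (int (k 2))"
  using assms
proof (induction m arbitrary: k)
  case 0
  show ?case
    by (simp add: arc_states_0 chamber_walks_0)
next
  case (Suc m)
  define W where "W = chamber_walks m"
  have IH: "int (card (arc_states N m (Suc m) k)) = W (int (k 1)) (int (k 2))" for k
    unfolding W_def using Suc by simp
  \<comment> \<open>The vanishing on the walls accounts for the zero branches in
    \<open>card_arc_states_open\<close>, where no arc of the colour is open.\<close>
  have wall: "W (- 1) b = 0" "W b (- 1) = 0" for b
    by (simp_all add: W_def chamber_walks_wall1 chamber_walks_wall2)
  have op: "int (card (arc_states N (Suc m) (Suc m) k)) =
      W (int (k 1)) (int (k 2)) + W (int (k 1) - 1) (int (k 2)) + W (int (k 1)) (int (k 2) - 1)" for k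
  proof -
    have "int (if k 1 = 0 then 0 else card (arc_states N m (Suc m) (k(1 := k 1 - 1)))) = W (int (k 1) - 1) (int (k 2))"
      by (cases "k 1 = 0") (simp_all add: IH wall of_nat_diff)
    moreover have "int (if k 2 = 0 then 0 else card (arc_states N m (Suc m) (k(2 := k 2 - 1)))) = W (int (k 1)) (int (k 2) - 1)"
      by (cases "k 2 = 0") (simp_all add: IH wall of_nat_diff)
    ultimately show ?thesis
      using card_arc_states_open[of "Suc m" m N k] Suc.prems IH[of k] by (simp only: of_nat_add)
  qed
  have "int (card (arc_states N (Suc m) (Suc (Suc m)) k)) = int (card (arc_states N (Suc m) (Suc m) k))
    + int (card (arc_states N (Suc m) (Suc m) (k(1 := k 1 + 1)))) + int (card (arc_states N (Suc m) (Suc m) (k(2 := k 2 + 1))))"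
    using card_arc_states_close[of "Suc m" "Suc m" N k] Suc.prems by simp
  then show ?case
    unfolding op chamber_walks_Suc W_def[symmetric] by (simp add: algebra_simps)
qed

section \<open>Partitions and their arcs\<close>

lemma arcs_less: "(i, j) \<in> arcs P \<Longrightarrow> i < j"
  by (auto simp: arcs_def)

lemma arcs_same_block:
  assumes P: "partition_on A P" and B: "B \<in> P" and ij: "(i, j) \<in> (arcs P)\<^sup>*"
  shows "i \<in> B \<longleftrightarrow> j \<in> B"
  using ij
proof induction
  case (step j k)
  from step(2) obtain C where "C \<in> P" "j \<in> C" "k \<in> C"
    by (auto simp: arcs_def)
  then have "j \<in> B \<longleftrightarrow> k \<in> B"
    using partition_onD2[OF P] B by (auto simp: disjoint_def)
  then show ?case
    using step by blast
qed simp

text \<open>The successor of \<open>i\<close> in its block is at most \<open>j\<close>, so following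
  arcs decreases the distance until \<open>j\<close> is reached.\<close>

lemma same_block_arcs_path:
  assumes "B \<in> P" "i \<in> B" "j \<in> B" "i < j"
  shows "(i, j) \<in> (arcs P)\<^sup>*"
  using assms
proof (induction "j - i" arbitrary: i rule: less_induct)
  case less
  define k where "k = (LEAST k. k \<in> B \<and> i < k)"
  have k: "k \<in> B \<and> i < k"
    unfolding k_def by (rule LeastI[of _ j]) (use less in auto)
  have le: "k \<le> x" if "x \<in> B" "i < x" for x
    unfolding k_def by (rule Least_le) (use that in auto)
  have arc: "(i, k) \<in> arcs P"
    using less.prems k le by (auto simp: arcs_def)
  show ?case
  proof (cases "k = j")
    case True
    then show ?thesis using arc by auto
  next
    case False
    then have "k < j"
      using le[of j] less.prems by auto
    then have "(k, j) \<in> (arcs P)\<^sup>*"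
      using less.hyps[of k] less.prems k by auto
    with arc show ?thesis
      by (rule converse_rtrancl_into_rtrancl)
  qed
qed

text \<open>Two elements share a block exactly when a path of arcs joins the smaller to the larger,
  so the arcs determine the blocks.\<close>

lemma eq_arcs_imp_blocks_subset:
  assumes P: "partition_on A P" and Q: "partition_on A Q" and eq: "arcs P = arcs Q"
  shows "P \<subseteq> Q"
proof
  fix B assume B: "B \<in> P"
  then obtain b where b: "b \<in> B"
    using partition_onD3[OF P] by (metis ex_in_conv)
  then obtain C where C: "C \<in> Q" "b \<in> C"
    using B partition_onD1[OF P] partition_onD1[OF Q] by blast
  have sub: "x \<in> C" if "B \<in> P" "b \<in> B" "x \<in> B" "C \<in> Q" "b \<in> C" "partition_on A Q" "arcs P = arcs Q"
    for x B C P Q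
  proof (cases b x rule: linorder_cases)
    case less
    then show ?thesis
      using same_block_arcs_path[of B P b x] arcs_same_block[of A Q C b x] that by simp
  next
    case greater
    then show ?thesis
      using same_block_arcs_path[of B P x b] arcs_same_block[of A Q C x b] that by simp
  qed (use that in simp)
  have "B = C"
    using sub[OF B b _ C Q eq] sub[OF C _ B b P eq[symmetric]] by blast
  then show "B \<in> Q"
    using C by simp
qed

lemma arcs_inj_on_partitions: "inj_on arcs {P. partition_on A P}"
  by (intro inj_onI equalityI) (auto intro: eq_arcs_imp_blocks_subset[THEN subsetD])

text \<open>
  The blocks are the classes of comparability under \<open>E\<^sup>*\<close>; uniqueness of successors and of predecessors
  makes comparability transitive.
\<close>

lemma ex_partition_with_arcs:
  fixes E :: "(nat \<times> nat) set"
  assumes sub: "E \<subseteq> A \<times> A" and less: "\<And>i j. (i, j) \<in> E \<Longrightarrow> i < j"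
    and left: "single_valued E" and right: "single_valued (E\<inverse>)"
  shows "\<exists>P. partition_on A P \<and> arcs P = E"
proof -
  define R where "R = {(x, y) \<in> A \<times> A. (x, y) \<in> E\<^sup>* \<or> (y, x) \<in> E\<^sup>*}"
  have mono: "i \<le> j" if "(i, j) \<in> E\<^sup>*" for i j
    using that by induction (auto dest: less)
  have up: "(x, y) \<in> E\<^sup>* \<or> (y, x) \<in> E\<^sup>*" if "(z, x) \<in> E\<^sup>*" "(z, y) \<in> E\<^sup>*" for x y z
    using single_valued_confluent[OF left that] .
  have down: "(x, y) \<in> E\<^sup>* \<or> (y, x) \<in> E\<^sup>*" if "(x, z) \<in> E\<^sup>*" "(y, z) \<in> E\<^sup>*" for x y z
    using single_valued_confluent[OF right, of z x y] that by (auto simp: rtrancl_converse)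
  have "equiv A R"
  proof (rule equivI)
    show "R \<subseteq> A \<times> A" by (auto simp: R_def)
    show "refl_on A R" by (auto simp: R_def refl_on_def)
    show "sym R" by (auto simp: R_def sym_def)
    show "trans R"
    proof (rule transI)
      fix x y z assume "(x, y) \<in> R" "(y, z) \<in> R"
      then show "(x, z) \<in> R"
        using up[of y x z] down[of x y z] rtrancl_trans[of x y E z] rtrancl_trans[of z y E x]
        unfolding R_def by blast
    qed
  qed
  then have part: "partition_on A (A // R)"
    by (rule partition_on_quotient)
  have "arcs (A // R) = E"
  proof (intro equalityI subrelI)
    fix i j assume "(i, j) \<in> arcs (A // R)"
    then obtain B where B: "B \<in> A // R" "i \<in> B" "j \<in> B" "i < j" and min: "\<And>k. k \<in> B \<Longrightarrow> i < k \<Longrightarrow> j \<le> k"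
      by (auto simp: arcs_def)
    have "(i, j) \<in> R"
      using quotient_eq_iff[OF \<open>equiv A R\<close> B(1) B(1) B(2,3)] by simp
    then have "(i, j) \<in> E\<^sup>*"
      using mono[of j i] B(4) by (auto simp: R_def)
    \<comment> \<open>The first arc \<open>(i, k)\<close> of the path stays in the block, so
      minimality of \<open>j\<close> forces \<open>j = k\<close>.\<close>
    then obtain k where k: "(i, k) \<in> E" "(k, j) \<in> E\<^sup>*"
      using B(4) by (metis converse_rtranclE less_irrefl)
    have "(i, k) \<in> R"
      using k(1) sub by (auto simp: R_def)
    then have "k \<in> B"
      using in_quotient_imp_closed[OF \<open>equiv A R\<close> B(1,2)] by blast
    then have "j = k"
      using min[of k] less[OF k(1)] mono[OF k(2)] by simp
    then show "(i, j) \<in> E"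
      using k by simp
  next
    fix i j assume ij: "(i, j) \<in> E"
    then have iA: "i \<in> A" and jR: "(i, j) \<in> R" and iR: "(i, i) \<in> R"
      using sub by (auto simp: R_def)
    have "j \<le> k" if k: "(i, k) \<in> R" "i < k" for k
    proof -
      have "(i, k) \<in> E\<^sup>*"
        using k mono[of k i] by (auto simp: R_def)
      then obtain j' where "(i, j') \<in> E" "(j', k) \<in> E\<^sup>*"
        using k(2) by (metis converse_rtranclE less_irrefl)
      then show ?thesis
        using single_valuedD[OF left ij] mono by metis
    qed
    then show "(i, j) \<in> arcs (A // R)"
      unfolding arcs_def using quotientI[OF iA, of R] jR iR less[OF ij]
      by (auto intro!: bexI[of _ "R `` {i}"])
  qed
  with part show ?thesis by blast
qed

definition colored_arcs :: "nat set set \<times> (nat \<times> nat \<Rightarrow> nat) \<Rightarrow> (nat \<times> nat \<times> nat) set" where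
  "colored_arcs \<Lambda> = {(i, j, c). (i, j) \<in> arcs (fst \<Lambda>) \<and> c = snd \<Lambda> (i, j)}"

lemma arcs_unique:
  assumes "partition_on A P"
  shows "(i, j) \<in> arcs P \<Longrightarrow> (i, j') \<in> arcs P \<Longrightarrow> j = j'"
    and "(i, j) \<in> arcs P \<Longrightarrow> (i', j) \<in> arcs P \<Longrightarrow> i = i'"
proof -
  have eq: "B = C" if "B \<in> P" "C \<in> P" "x \<in> B" "x \<in> C" for B C x
    using partition_onD2[OF assms] that by (auto simp: disjoint_def)
  show "j = j'" if arcs: "(i, j) \<in> arcs P" "(i, j') \<in> arcs P"
  proof -
    obtain B C where B: "B \<in> P" "i \<in> B" "j \<in> B" "i < j" "\<And>k. k \<in> B \<Longrightarrow> i < k \<Longrightarrow> j \<le> k"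
      and C: "C \<in> P" "i \<in> C" "j' \<in> C" "i < j'" "\<And>k. k \<in> C \<Longrightarrow> i < k \<Longrightarrow> j' \<le> k"
      using arcs unfolding arcs_def by blast
    have "B = C" using eq[OF B(1) C(1) B(2) C(2)] .
    then show ?thesis
      using B(5)[of j'] C(5)[of j] B(3,4) C(3,4) by simp
  qed
  show "i = i'" if arcs: "(i, j) \<in> arcs P" "(i', j) \<in> arcs P"
  proof -
    obtain B C where B: "B \<in> P" "i \<in> B" "j \<in> B" "i < j" "\<And>k. k \<in> B \<Longrightarrow> i < k \<Longrightarrow> j \<le> k"
      and C: "C \<in> P" "i' \<in> C" "j \<in> C" "i' < j" "\<And>k. k \<in> C \<Longrightarrow> i' < k \<Longrightarrow> j \<le> k"
      using arcs unfolding arcs_def by blast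
    have "B = C" using eq[OF B(1) C(1) B(3) C(3)] .
    then show ?thesis
      using B(5)[of i'] C(5)[of i] B(2,4) C(2,4) by (cases i i' rule: linorder_cases) simp_all
  qed
qed

lemma arcs_in: "partition_on A P \<Longrightarrow> (i, j) \<in> arcs P \<Longrightarrow> i \<in> A \<and> j \<in> A"
  by (auto simp: arcs_def partition_on_def)

text \<open>With \<open>Suc n\<close> as sentinel and no open arcs, a diagram is just a set of
  coloured arcs. Injectivity uses that arcs determine the partition and that colourings are
  extensional; surjectivity rebuilds the partition from the arcs.\<close>

lemma bij_betw_colored_arcs:
  "bij_betw colored_arcs {\<Lambda> \<in> colored_partitions n. noncrossing_colored \<Lambda>}
     (arc_states (Suc n) n n (\<lambda>_. 0))" (is "bij_betw _ ?L ?X")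
  unfolding bij_betw_def
proof (intro conjI inj_onI equalityI subsetI)
  fix \<Lambda> \<Lambda>' assume L: "\<Lambda> \<in> ?L" "\<Lambda>' \<in> ?L" and eq: "colored_arcs \<Lambda> = colored_arcs \<Lambda>'"
  obtain P \<phi> Q \<psi> where \<Lambda>: "\<Lambda> = (P, \<phi>)" "\<Lambda>' = (Q, \<psi>)"
    by (cases \<Lambda>, cases \<Lambda>')
  have P: "partition_on {1..n} P" "\<phi> \<in> arcs P \<rightarrow>\<^sub>E {1, 2}" and Q: "partition_on {1..n} Q" "\<psi> \<in> arcs Q \<rightarrow>\<^sub>E {1, 2}"
    using L by (simp_all add: \<Lambda> colored_partitions_def)
  have mem: "(i, j) \<in> arcs P \<and> c = \<phi> (i, j) \<longleftrightarrow> (i, j) \<in> arcs Q \<and> c = \<psi> (i, j)" for i j c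
    using arg_cong[OF eq, of "\<lambda>S. (i, j, c) \<in> S"] by (simp add: \<Lambda> colored_arcs_def)
  then have arcs: "arcs P = arcs Q"
    by auto
  then have "P = Q"
    using inj_onD[OF arcs_inj_on_partitions arcs] P(1) Q(1) by simp
  moreover have "\<phi> = \<psi>"
  proof (rule extensionalityI[of _ "arcs P"])
    show "\<phi> \<in> extensional (arcs P)" "\<psi> \<in> extensional (arcs P)"
      using P(2) Q(2) arcs by (auto simp: PiE_def)
    show "\<phi> a = \<psi> a" if "a \<in> arcs P" for a
      using mem[of "fst a" "snd a" "\<phi> a"] that by simp
  qed
  ultimately show "\<Lambda> = \<Lambda>'"
    by (simp add: \<Lambda>)
next
  fix X assume "X \<in> colored_arcs ` ?L"
  then obtain P \<phi> where X: "X = colored_arcs (P, \<phi>)" and P: "partition_on {1..n} P"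
    and \<phi>: "\<phi> \<in> arcs P \<rightarrow>\<^sub>E {1, 2}" and nc: "noncrossing_colored (P, \<phi>)"
    by (auto simp: colored_partitions_def)
  have mem: "(i, j, c) \<in> X \<longleftrightarrow> (i, j) \<in> arcs P \<and> c = \<phi> (i, j)" for i j c
    by (simp add: X colored_arcs_def)
  note in_range = arcs_in[OF P] and uniq = arcs_unique[OF P]
  have "X \<in> arc_configs (Suc n) n n"
  proof (rule arc_configsI)
    fix i j c assume "(i, j, c) \<in> X"
    then show "1 \<le> i \<and> i \<le> n \<and> (1 \<le> j \<and> j \<le> n \<or> j = Suc n) \<and> (c = 1 \<or> c = 2) \<and> i < j"
      using in_range[of i j] arcs_less[of i j P] PiE_mem[OF \<phi>, of "(i, j)"] by (auto simp: mem)
  next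
    fix i j c j' c' assume "(i, j, c) \<in> X" "(i, j', c') \<in> X"
    then show "j = j' \<and> c = c'"
      using uniq(1)[of i j j'] by (auto simp: mem)
  next
    fix i j c i' c' assume "(i, j, c) \<in> X" "(i', j, c') \<in> X"
    then show "i = i'"
      using uniq(2)[of i j i'] by (auto simp: mem)
  next
    fix i j i' j' c assume "(i, j, c) \<in> X" "(i', j', c) \<in> X"
    then have "(i, j) \<in> arcs P" "(i', j') \<in> arcs P" "\<phi> (i, j) = \<phi> (i', j')"
      by (simp_all add: mem)
    then have "\<not> crossing (i, j) (i', j')"
      using nc unfolding noncrossing_colored_def fst_conv snd_conv by blast
    then show "\<not> (i < i' \<and> i' < j \<and> j < j')"
      by (simp add: crossing_def)
  qed
  moreover have "open_arcs (Suc n) X c = {}" for c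
    using in_range[of _ "Suc n"] by (auto simp: open_arcs_def mem)
  ultimately show "X \<in> ?X"
    by (simp add: arc_states_def)
next
  fix X assume "X \<in> ?X"
  then have X: "X \<in> arc_configs (Suc n) n n" and card: "\<forall>c\<in>{1, 2}. card (open_arcs (Suc n) X c) = 0"
    by (simp_all add: arc_states_def)
  note D = arc_configsD[OF X]
  have in_range: "1 \<le> i \<and> i \<le> n \<and> 1 \<le> j \<and> j \<le> n \<and> (c = 1 \<or> c = 2) \<and> i < j" if "(i, j, c) \<in> X" for i j c
  proof -
    have "j \<noteq> Suc n"
    proof
      assume "j = Suc n"
      then have "i \<in> open_arcs (Suc n) X c"
        using that by (simp add: open_arcs_def)
      moreover have "card (open_arcs (Suc n) X c) = 0"
        using card D(1)[OF that] by auto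
      ultimately show False
        using finite_open_arcs[OF X, of c] by auto
    qed
    then show ?thesis using D(1)[OF that] by blast
  qed
  define E where "E = {(i, j). \<exists>c. (i, j, c) \<in> X}"
  have "\<exists>P. partition_on {1..n} P \<and> arcs P = E"
  proof (rule ex_partition_with_arcs)
    show "E \<subseteq> {1..n} \<times> {1..n}"
      using in_range by (fastforce simp: E_def)
    show "i < j" if "(i, j) \<in> E" for i j
      using in_range that by (auto simp: E_def)
    show "single_valued E"
    proof (rule single_valuedI)
      fix i j j' assume "(i, j) \<in> E" "(i, j') \<in> E"
      then show "j = j'" unfolding E_def using D(2) by blast
    qed
    show "single_valued (E\<inverse>)"
    proof (rule single_valuedI)
      fix j i i' assume "(j, i) \<in> E\<inverse>" "(j, i') \<in> E\<inverse>"
      then obtain c c' where *: "(i, j, c) \<in> X" "(i', j, c') \<in> X"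
        by (auto simp: E_def)
      then show "i = i'"
        using D(3)[OF *] in_range[OF *(1)] by simp
    qed
  qed
  then obtain P where P: "partition_on {1..n} P" "arcs P = E"
    by blast
  \<comment> \<open>Each arc occurs with one colour only, and the restriction to \<open>E\<close>
    makes the colouring extensional.\<close>
  define \<phi> where "\<phi> = (\<lambda>a\<in>E. THE c. (fst a, snd a, c) \<in> X)"
  have \<phi>: "\<phi> (i, j) = c" if "(i, j, c) \<in> X" for i j c
  proof -
    have "(THE c. (i, j, c) \<in> X) = c"
      using that D(2)[OF _ that] by blast
    moreover have "(i, j) \<in> E" using that by (auto simp: E_def)
    ultimately show ?thesis
      by (simp add: \<phi>_def)
  qed
  have colored: "colored_arcs (P, \<phi>) = X"
  proof -
    have "x \<in> colored_arcs (P, \<phi>) \<longleftrightarrow> x \<in> X" for x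
    proof -
      obtain i j c where x: "x = (i, j, c)" by (cases x)
      show ?thesis
        using \<phi>[of i j] by (auto simp: x colored_arcs_def P(2) E_def)
    qed
    then show ?thesis by blast
  qed
  moreover have "(P, \<phi>) \<in> ?L"
  proof -
    have "\<phi> \<in> arcs P \<rightarrow>\<^sub>E {1, 2}"
    proof (rule PiE_I)
      fix a assume "a \<in> arcs P"
      then obtain i j c where *: "a = (i, j)" "(i, j, c) \<in> X"
        by (cases a) (auto simp: P(2) E_def)
      then show "\<phi> a \<in> {1, 2}"
        using \<phi>[OF *(2)] in_range[OF *(2)] by simp
    qed (simp add: \<phi>_def P(2))
    moreover have "noncrossing_colored (P, \<phi>)"
      unfolding noncrossing_colored_def
    proof (intro notI, elim bexE conjE)
      fix a b assume ab: "a \<in> arcs (fst (P, \<phi>))" "b \<in> arcs (fst (P, \<phi>))" "crossing a b"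
        "snd (P, \<phi>) a = snd (P, \<phi>) b"
      obtain i j i' j' where a: "a = (i, j)" "b = (i', j')"
        by (cases a, cases b)
      have "(i, j, \<phi> a) \<in> X" "(i', j', \<phi> a) \<in> X"
        using ab unfolding colored[symmetric] by (simp_all add: colored_arcs_def a)
      then show False
        using D(4) ab(3) unfolding crossing_def a by fastforce
    qed
    ultimately show ?thesis
      using P(1) by (simp add: colored_partitions_def)
  qed
  ultimately show "X \<in> colored_arcs ` ?L"
    by blast
qed

section \<open>The count, its recurrence and D-finiteness\<close>

lemma C2_Suc_eq_chamber_walks: "int (C2 (Suc m)) = chamber_walks m 0 0"
proof -
  have "C2 (Suc m) = card (arc_states (Suc (Suc m)) (Suc m) (Suc m) (\<lambda>_. 0))"
    unfolding C2_def by (rule bij_betw_same_card[OF bij_betw_colored_arcs])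
  \<comment> \<open>The last vertex opens nothing: with both counts zero only the first summand of
    \<open>card_arc_states_open\<close> survives.\<close>
  also have "\<dots> = card (arc_states (Suc (Suc m)) m (Suc m) (\<lambda>_. 0))"
    by (subst card_arc_states_open) simp_all
  finally show ?thesis
    using card_arc_states_eq_chamber_walks[of m "Suc (Suc m)" "\<lambda>_. 0"] by simp
qed

lemma C2_recurrence:
  "9 * int n * (int n + 3) * int (C2 n) - 2 * (5 * (int n)\<^sup>2 + 26 * int n + 30) * int (C2 (n + 1))
     + (int n + 4) * (int n + 5) * int (C2 (n + 2)) = 0"
proof (cases n)
  case 0
  \<comment> \<open>For \<open>n = 0\<close> the term with \<open>C2 0\<close> vanishes, and -60 * 1
    + 20 * 3 = 0.\<close>
  have "int (C2 (Suc 0)) = 1" "int (C2 (Suc (Suc 0))) = 3"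
    by (simp_all add: C2_Suc_eq_chamber_walks chamber_walks_def)
  then show ?thesis
    by (simp add: 0 numeral_2_eq_2)
next
  case (Suc m)
  have e: "n + 1 = Suc (m + 1)" "n + 2 = Suc (m + 2)" "int n = int m + 1"
    using Suc by simp_all
  show ?thesis
    using chamber_walks_0_0_recurrence[of m]
    unfolding e unfolding Suc C2_Suc_eq_chamber_walks by (simp add: add.assoc)
qed

lemma D_finite_C2: "D_finite (Abs_fps (\<lambda>n. of_nat (C2 n)))"
proof (rule D_finite_second_order)
  show "[:0, 0, 1, - 10, 9:] \<noteq> (0 :: rat poly)"
    by simp
  show "fps_of_poly [:0, 0, 1, - 10, 9:] * fps_deriv (fps_deriv (Abs_fps (\<lambda>n. of_nat (C2 n) :: rat))) =
      fps_of_poly [:6, - 6:] + fps_of_poly [:- 6, 18:] * Abs_fps (\<lambda>n. of_nat (C2 n))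
      + fps_of_poly [:0, - 6, 42, - 36:] * fps_deriv (Abs_fps (\<lambda>n. of_nat (C2 n)))"
  proof (rule fps_ode_of_recurrence)
    have "int (C2 (Suc 0)) = 1"
      by (simp add: C2_Suc_eq_chamber_walks chamber_walks_def)
    then show "of_nat (C2 1) = (1 :: rat)"
      by simp
    show "9 * of_nat n * (of_nat n + 3) * (of_nat (C2 n) :: rat)
        - 2 * (5 * (of_nat n)\<^sup>2 + 26 * of_nat n + 30) * of_nat (C2 (n + 1))
        + (of_nat n + 4) * (of_nat n + 5) * of_nat (C2 (n + 2)) = 0" for n
      using arg_cong[OF C2_recurrence[of n], of "of_int :: int \<Rightarrow> rat"] by simp
  qed (simp add: C2_0)
qed

theorem theorem1p7:
  shows "(\<forall>n\<ge>1. int (C2 n) = const_coeff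
            ((1 - mon 2 (-1) + mon 3 0 - mon 2 2 + mon 0 3 - mon (-1) 2) *
             (3 + mon 1 0 + mon 0 1 + mon (-1) 0 + mon 0 (-1) + mon 1 (-1) + mon (-1) 1) ^ (n - 1)))
       \<and> (\<forall>n. 9 * int n * (int n + 3) * int (C2 n)
              - 2 * (5 * (int n)\<^sup>2 + 26 * int n + 30) * int (C2 (n + 1))
              + (int n + 4) * (int n + 5) * int (C2 (n + 2)) = 0)
       \<and> D_finite (Abs_fps (\<lambda>n. of_nat (C2 n)))"
proof (intro conjI allI impI)
  fix n :: nat assume "n \<ge> 1"
  then obtain m where "n = Suc m"
    by (cases n) auto
  then show "int (C2 n) = const_coeff
      ((1 - mon 2 (-1) + mon 3 0 - mon 2 2 + mon 0 3 - mon (-1) 2) *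
       (3 + mon 1 0 + mon 0 1 + mon (-1) 0 + mon 0 (-1) + mon 1 (-1) + mon (-1) 1) ^ (n - 1))"
    using const_coeff_eq_chamber_walks[of m, unfolded step_poly_def]
    by (simp only: C2_Suc_eq_chamber_walks diff_Suc_1)
qed (fact C2_recurrence D_finite_C2)+

end
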